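(* Let $R(z)\in\mathbb{C}(z)^{m\times m}$ be a rational matrix. Then $R(z)$ is para-Hermitian (resp., para-skew-Hermitian) if and only if there exists a strongly minimal $*$-palindromic (resp., strongly minimal $*$-anti-palindromic) linearization of $(1+z)R(z)$.
   Context: For a rational matrix $R(t)$ with complex coefficients, $R^*(t):=[R(\overline{t})]^*$ (the coefficients are conjugate-transposed, the variable is not conjugated); i.e. $(R^* )_{ij}(t)=\overline{R_{ji}(\overline{t})}$. A square rational matrix $R(z)$ is para-Hermitian if $R^*(z)=R(1/z)$, and para-skew-Hermitian if $R^*(z)=-R(1/z)$. A pencil is a polynomial matrix of the form $L(z)=zL_1+L_0$ with constant matrices $L_1,L_0$. For a rational matrix $H(z)$ put $\mathrm{rev}_1 H(z):=zH(1/z)$. A square pencil $L(z)$ is $*$-palindromic if $\mathrm{rev}_1L^*(z)=L(z)$ (i.e. $L(z)=zL_0^*+L_0$), and $*$-anti-palindromic if $\mathrm{rev}_1L^*(z)=-L(z)$ (i.e. $L_0=-L_1^*$). A linear system matrix is a block-partitioned complex pencil $$L(z)=\begin{bmatrix}-A(z)&B(z)\\ C(z)&D(z)\end{bmatrix}=\begin{bmatrix}-zA_1+A_0& zB_1-B_0\\ zC_1-C_0& zD_1-D_0\end{bmatrix}$$ with $A(z)$ a $p\times p$ regular pencil ($\det A(z)\not\equiv0$), $p\ge 0$ (for $p=0$ the blocks $A,B,C$ are empty). Its transfer function is the rational matrix $D(z)+C(z)A(z)^{-1}B(z)$. It is minimal if $\begin{bmatrix}-A(z_0)&B(z_0)\end{bmatrix}$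 has full row rank and $\begin{bmatrix}-A(z_0)\\ C(z_0)\end{bmatrix}$ has full column rank for all $z_0\in\mathbb{C}$; it is minimal at $\infty$ if $\begin{bmatrix}-A_1&B_1\end{bmatrix}$ has full row rank and $\begin{bmatrix}-A_1\\ C_1\end{bmatrix}$ has full column rank; it is strongly minimal if it is minimal and minimal at $\infty$. A strongly minimal linearization of a rational matrix $H(z)$ is a strongly minimal linear system matrix whose transfer function is $H(z)$. *)

theory Defs
  imports
    "Jordan_Normal_Form.DL_Rank"
    "Jordan_Normal_Form.Gauss_Jordan_Elimination"
    "HOL-Computational_Algebra.Computational_Algebra"
    "HOL-Computational_Algebra.Field_as_Ring"
begin

section \<open>Rational functions and rational matrices\<close>

text \<open>Rational functions are elements of the fraction field of \<open>\<complex>[z]\<close>; the indeterminate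
  \<open>z\<close> is \<open>[:0, 1:]\<close>. The next two operations use the normalized numerator and denominator;
  \<open>rat_cnj_Fract\<close> and \<open>rat_recip_Fract\<close> below show that any other representative may be used.\<close>

type_synonym ratfun = "complex poly fract"

text \<open>\<open>r(t) \<mapsto> cnj (r (cnj t))\<close>: only the coefficients are conjugated.\<close>

definition rat_cnj :: "ratfun \<Rightarrow> ratfun" where
  "rat_cnj r = (case quot_of_fract r of (a, b) \<Rightarrow> Fract (map_poly cnj a) (map_poly cnj b))"

text \<open>\<open>q(z) \<mapsto> q(1/z)\<close>: the coefficients become constants of \<open>\<complex>(z)\<close>, and the resulting
  polynomial over \<open>\<complex>(z)\<close> is evaluated at \<open>1/z\<close>.\<close>

definition poly_recip :: "complex poly \<Rightarrow> ratfun" where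
  "poly_recip q = poly (map_poly (\<lambda>c. to_fract [:c:]) q) (inverse (to_fract [:0, 1:]))"

definition rat_recip :: "ratfun \<Rightarrow> ratfun" where
  "rat_recip r = (case quot_of_fract r of (a, b) \<Rightarrow> poly_recip a / poly_recip b)"

lemma rat_cnj_Fract:
  assumes "b \<noteq> 0"
  shows "rat_cnj (Fract a b) = Fract (map_poly cnj a) (map_poly cnj b)"
proof -
  obtain c d where cd: "quot_of_fract (Fract a b) = (c, d)" by fastforce
  have d: "d \<noteq> 0" using snd_quot_of_fract_nonzero[of "Fract a b"] cd by simp
  have "Fract a b = Fract c d"
    using quot_to_fract_quot_of_fract[of "Fract a b"] cd by (simp add: quot_to_fract_def)
  hence "a * d = c * b" using assms d by (simp add: eq_fract)
  hence "map_poly cnj (a * d) = map_poly cnj (c * b)" by simp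
  moreover have "map_poly cnj (p * q) = map_poly cnj p * map_poly cnj q" for p q
    by (rule poly_eqI) (simp add: coeff_map_poly coeff_mult)
  ultimately have "map_poly cnj a * map_poly cnj d = map_poly cnj c * map_poly cnj b" by simp
  moreover have "map_poly cnj b \<noteq> 0" "map_poly cnj d \<noteq> 0"
    using assms d by (simp_all add: map_poly_eq_0_iff)
  ultimately show ?thesis unfolding rat_cnj_def cd by (simp add: eq_fract)
qed

lemma poly_recip_mult: "poly_recip (p * q) = poly_recip p * poly_recip q"
proof -
  have "to_fract [:\<Sum>i\<in>I. f i:] = (\<Sum>i\<in>I. to_fract [:f i:])"
    if "finite I" for I :: "nat set" and f :: "nat \<Rightarrow> complex"
    using that
  proof (induction I)
    case (insert x I)
    have "[:\<Sum>i\<in>insert x I. f i:] = [:f x:] + [:\<Sum>i\<in>I. f i:]"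
      using insert.hyps by simp
    thus ?case using insert by (simp only: to_fract_add sum.insert simp_thms)
  qed simp
  hence "map_poly (\<lambda>c. to_fract [:c:]) (p * q)
      = map_poly (\<lambda>c. to_fract [:c:]) p * map_poly (\<lambda>c. to_fract [:c:]) q"
    by (intro poly_eqI) (simp add: coeff_map_poly coeff_mult mult.commute flip: to_fract_mult)
  thus ?thesis by (simp add: poly_recip_def)
qed

lemma poly_recip_nonzero:
  assumes "p \<noteq> 0"
  shows "poly_recip p \<noteq> 0"
proof -
  let ?X = "to_fract [:0, 1:] :: ratfun" and ?q = "map_poly (\<lambda>c. to_fract [:c:] :: ratfun)"
  have X: "?X \<noteq> 0" by simp
  have "poly (?q r) ?X = to_fract r" for r
  proof (induction r)
    case (pCons c r)
    hence "poly (?q (pCons c r)) ?X = to_fract [:c:] + ?X * to_fract r"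
      by (simp add: map_poly_pCons)
    also have "\<dots> = to_fract ([:c:] + [:0, 1:] * r)"
      by (simp only: to_fract_add to_fract_mult)
    also have "[:c:] + [:0, 1:] * r = pCons c r" by simp
    finally show ?case .
  qed simp
  moreover have "reflect_poly (?q p) = ?q (reflect_poly p)"
    by (rule poly_eqI)
       (simp add: coeff_reflect_poly coeff_map_poly degree_map_poly)
  ultimately have "to_fract (reflect_poly p) = ?X ^ degree (?q p) * poly_recip p"
    using poly_reflect_poly_nz[OF X, of "?q p"] by (simp add: poly_recip_def)
  thus ?thesis using assms by auto
qed

lemma rat_recip_Fract:
  assumes "b \<noteq> 0"
  shows "rat_recip (Fract a b) = poly_recip a / poly_recip b"
proof -
  obtain c d where cd: "quot_of_fract (Fract a b) = (c, d)" by fastforce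
  have d: "d \<noteq> 0" using snd_quot_of_fract_nonzero[of "Fract a b"] cd by simp
  have "Fract a b = Fract c d"
    using quot_to_fract_quot_of_fract[of "Fract a b"] cd by (simp add: quot_to_fract_def)
  hence "a * d = c * b" using assms d by (simp add: eq_fract)
  hence "poly_recip a * poly_recip d = poly_recip c * poly_recip b"
    by (simp flip: poly_recip_mult)
  thus ?thesis unfolding rat_recip_def cd
    using poly_recip_nonzero[OF assms] poly_recip_nonzero[OF d] by (simp add: frac_eq_eq)
qed

definition mat_star :: "ratfun mat \<Rightarrow> ratfun mat" where
  "mat_star R = transpose_mat (map_mat rat_cnj R)"

definition mat_recip :: "ratfun mat \<Rightarrow> ratfun mat" where
  "mat_recip R = map_mat rat_recip R"

definition para_hermitian :: "ratfun mat \<Rightarrow> bool" where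
  "para_hermitian R \<longleftrightarrow> square_mat R \<and> mat_star R = mat_recip R"

definition para_skew_hermitian :: "ratfun mat \<Rightarrow> bool" where
  "para_skew_hermitian R \<longleftrightarrow> square_mat R \<and> mat_star R = - mat_recip R"

definition rev1 :: "ratfun mat \<Rightarrow> ratfun mat" where
  "rev1 H = to_fract [:0, 1:] \<cdot>\<^sub>m mat_recip H"

section \<open>Pencils\<close>

definition is_pencil :: "complex poly mat \<Rightarrow> bool" where
  "is_pencil L \<longleftrightarrow> (\<exists>L\<^sub>1 L\<^sub>0.
     L\<^sub>1 \<in> carrier_mat (dim_row L) (dim_col L) \<and> L\<^sub>0 \<in> carrier_mat (dim_row L) (dim_col L) \<and>
     L = [:0, 1:] \<cdot>\<^sub>m map_mat (\<lambda>c. [:c:]) L\<^sub>1 + map_mat (\<lambda>c. [:c:]) L\<^sub>0)"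

definition eval_mat :: "complex poly mat \<Rightarrow> complex \<Rightarrow> complex mat" where
  "eval_mat L z\<^sub>0 = map_mat (\<lambda>q. poly q z\<^sub>0) L"

text \<open>The matrix \<open>L\<^sub>1\<close> of a pencil \<open>z L\<^sub>1 + L\<^sub>0\<close>.\<close>

definition lead_mat :: "complex poly mat \<Rightarrow> complex mat" where
  "lead_mat L = map_mat (\<lambda>q. coeff q 1) L"

definition rat_mat :: "complex poly mat \<Rightarrow> ratfun mat" where
  "rat_mat L = map_mat to_fract L"

definition star_palindromic :: "complex poly mat \<Rightarrow> bool" where
  "star_palindromic L \<longleftrightarrow>
     is_pencil L \<and> square_mat L \<and> rev1 (mat_star (rat_mat L)) = rat_mat L"

definition star_anti_palindromic :: "complex poly mat \<Rightarrow> bool" where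
  "star_anti_palindromic L \<longleftrightarrow>
     is_pencil L \<and> square_mat L \<and> rev1 (mat_star (rat_mat L)) = - rat_mat L"

section \<open>Linear system matrices\<close>

text \<open>A linear system matrix is given by its four blocks \<open>A\<close>, \<open>B\<close>, \<open>C\<close>, \<open>D\<close>, of sizes
  \<open>p \<times> p\<close>, \<open>p \<times> n\<close>, \<open>m \<times> p\<close>, \<open>m \<times> n\<close>; note the sign of the upper left block of
  \<open>system_matrix\<close>. The case \<open>p = 0\<close> is allowed: then \<open>det A = 1\<close>, and the transfer function
  is \<open>D\<close>.\<close>

definition system_matrix ::
    "complex poly mat \<Rightarrow> complex poly mat \<Rightarrow> complex poly mat \<Rightarrow> complex poly mat \<Rightarrow> complex poly mat"
  where "system_matrix A B C D = four_block_mat (- A) B C D"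

definition linear_system ::
    "complex poly mat \<Rightarrow> complex poly mat \<Rightarrow> complex poly mat \<Rightarrow> complex poly mat \<Rightarrow> bool"
  where "linear_system A B C D \<longleftrightarrow> (\<exists>p m n.
     A \<in> carrier_mat p p \<and> B \<in> carrier_mat p n \<and> C \<in> carrier_mat m p \<and> D \<in> carrier_mat m n \<and>
     is_pencil A \<and> is_pencil B \<and> is_pencil C \<and> is_pencil D \<and> det A \<noteq> 0)"

definition transfer_function ::
    "complex poly mat \<Rightarrow> complex poly mat \<Rightarrow> complex poly mat \<Rightarrow> complex poly mat \<Rightarrow> ratfun mat"
  where "transfer_function A B C D =
     rat_mat D + rat_mat C * the (mat_inverse (rat_mat A)) * rat_mat B"

definition append_cols :: "'a :: zero mat \<Rightarrow> 'a mat \<Rightarrow> 'a mat" where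
  "append_cols M N = four_block_mat M N (0\<^sub>m 0 (dim_col M)) (0\<^sub>m 0 (dim_col N))"

definition full_row_rank :: "complex mat \<Rightarrow> bool" where
  "full_row_rank M \<longleftrightarrow> vec_space.rank (dim_row M) M = dim_row M"

definition full_col_rank :: "complex mat \<Rightarrow> bool" where
  "full_col_rank M \<longleftrightarrow> vec_space.rank (dim_row M) M = dim_col M"

definition minimal_system ::
    "complex poly mat \<Rightarrow> complex poly mat \<Rightarrow> complex poly mat \<Rightarrow> bool"
  where "minimal_system A B C \<longleftrightarrow> (\<forall>z\<^sub>0.
     full_row_rank (append_cols (- eval_mat A z\<^sub>0) (eval_mat B z\<^sub>0)) \<and>
     full_col_rank (append_rows (- eval_mat A z\<^sub>0) (eval_mat C z\<^sub>0)))"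

definition minimal_system_at_infinity ::
    "complex poly mat \<Rightarrow> complex poly mat \<Rightarrow> complex poly mat \<Rightarrow> bool"
  where "minimal_system_at_infinity A B C \<longleftrightarrow>
     full_row_rank (append_cols (- lead_mat A) (lead_mat B)) \<and>
     full_col_rank (append_rows (- lead_mat A) (lead_mat C))"

definition strongly_minimal ::
    "complex poly mat \<Rightarrow> complex poly mat \<Rightarrow> complex poly mat \<Rightarrow> bool"
  where "strongly_minimal A B C \<longleftrightarrow> minimal_system A B C \<and> minimal_system_at_infinity A B C"

definition strongly_minimal_linearization ::
    "complex poly mat \<Rightarrow> complex poly mat \<Rightarrow> complex poly mat \<Rightarrow> complex poly mat \<Rightarrow> ratfun mat \<Rightarrow> bool"
  where "strongly_minimal_linearization A B C D H \<longleftrightarrow>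
     linear_system A B C D \<and> strongly_minimal A B C \<and> transfer_function A B C D = H"

end

theory Submission
  imports Defs
begin

text \<open>Let \<open>L\<^sup>\<dagger>(z) = z L\<^sup>*(1/z)\<close>, an involution on rational matrices. A pencil is
  \<open>*\<close>-palindromic iff it is fixed by \<open>\<dagger>\<close>, and \<open>R\<close> is para-Hermitian iff \<open>H = (1+z) R\<close> is fixed
  by \<open>\<dagger>\<close>. Since \<open>\<dagger>\<close> commutes with taking transfer functions, a palindromic linearization of \<open>H\<close>
  forces \<open>H\<^sup>\<dagger> = H\<close>.

  Conversely, let \<open>H\<^sup>\<dagger> = H\<close>. A companion realization of \<open>H\<close> with state matrix \<open>M\<close>, combined with
  its image under \<open>\<dagger>\<close>, gives a palindromic realization of \<open>(H + H\<^sup>\<dagger>)/2 = H\<close> with state matrix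
  \<open>[0 M\<^sup>\<dagger>; M 0]\<close>. One with the least number of states is strongly minimal: if the columns
  \<open>[M; C]\<close> have a null vector \<open>x\<close> at some point of the projective line, then \<open>[M; C] x = \<mu> [a; c]\<close> for
  a scalar pencil \<open>\<mu>\<close> vanishing at that point and constant \<open>a \<noteq> 0\<close>, \<open>c\<close>. A constant change of variables
  makes \<open>c = 0\<close>, and by symmetry the state vector of the system is orthogonal to \<open>a\<close>. Hence the states
  can be restricted to \<open>a\<^sup>\<bottom>\<close> and, if \<open>x\<close> lies in it, further to a complement of \<open>x\<close> in it, without
  changing the transfer function. The row condition at \<open>z\<^sub>0\<close> is the column condition at the conjugate
  of \<open>1/z\<^sub>0\<close>. In the anti-palindromic case, \<open>H\<close> is replaced by \<open>\<i> H\<close>.\<close>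

section \<open>Conjugation and inversion of the variable\<close>

abbreviation Z :: ratfun where "Z \<equiv> to_fract [:0, 1:]"

definition cst :: "complex \<Rightarrow> ratfun" where "cst c = to_fract [:c:]"

text \<open>This is r(z) -> \<open>cnj (r (1 / cnj z))\<close>, which on the unit circle is
  pointwise complex conjugation. It is an involutive field automorphism of C(z) and takes the role
  that \<open>cnj\<close> has for complex Hermitian matrices.\<close>

definition conj_recip :: "ratfun \<Rightarrow> ratfun" where "conj_recip r = rat_recip (rat_cnj r)"

interpretation cst: field_hom cst
  by unfold_locales (simp_all add: cst_def flip: to_fract_add to_fract_mult one_pCons)

lemma poly_recip_add: "poly_recip (p + q) = poly_recip p + poly_recip q"
proof -
  have "map_poly (\<lambda>c. to_fract [:c:]) (p + q) =
      map_poly (\<lambda>c. to_fract [:c:]) p + map_poly (\<lambda>c. to_fract [:c:] :: ratfun) q"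
    by (intro poly_eqI) (simp add: coeff_map_poly flip: to_fract_add)
  thus ?thesis by (simp add: poly_recip_def)
qed

lemma poly_recip_const [simp]: "poly_recip [:c:] = cst c"
  by (simp add: poly_recip_def map_poly_pCons cst_def)

lemma poly_recip_X [simp]: "poly_recip [:0, 1:] = inverse Z"
  by (simp add: poly_recip_def map_poly_pCons flip: one_pCons)

lemma poly_recip_0 [simp]: "poly_recip 0 = 0" and poly_recip_1 [simp]: "poly_recip 1 = 1"
  by (simp_all add: poly_recip_def flip: one_pCons)

lemma rat_recip_to_fract [simp]: "rat_recip (to_fract p) = poly_recip p"
  using rat_recip_Fract[of 1 p] by (simp add: to_fract_def)

lemma rat_cnj_to_fract [simp]: "rat_cnj (to_fract p) = to_fract (map_poly cnj p)"
  using rat_cnj_Fract[of 1 p] by (simp add: to_fract_def)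

interpretation rat_recip: field_hom rat_recip
proof unfold_locales
  fix x y :: ratfun
  obtain a b where x: "x = Fract a b" "b \<noteq> 0" by (cases x)
  obtain c d where y: "y = Fract c d" "d \<noteq> 0" by (cases y)
  note nz = poly_recip_nonzero[OF x(2)] poly_recip_nonzero[OF y(2)]
  show "rat_recip (x + y) = rat_recip x + rat_recip y"
    using x y nz by (simp add: rat_recip_Fract poly_recip_add poly_recip_mult field_simps)
  show "rat_recip (x * y) = rat_recip x * rat_recip y"
    using x y nz by (simp add: rat_recip_Fract poly_recip_mult)
next
  show "rat_recip 0 = 0" "rat_recip 1 = 1"
    using rat_recip_to_fract[of 0] rat_recip_to_fract[of 1] by simp_all
qed

lemma map_poly_cnj_add: "map_poly cnj (p + q) = map_poly cnj p + map_poly cnj q"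
  by (rule poly_eqI) (simp add: coeff_map_poly)

lemma map_poly_cnj_mult: "map_poly cnj (p * q) = map_poly cnj p * map_poly cnj q"
  by (rule poly_eqI) (simp add: coeff_map_poly coeff_mult)

interpretation rat_cnj: field_hom rat_cnj
proof unfold_locales
  fix x y :: ratfun
  obtain a b where x: "x = Fract a b" "b \<noteq> 0" by (cases x)
  obtain c d where y: "y = Fract c d" "d \<noteq> 0" by (cases y)
  have nz: "map_poly cnj b \<noteq> 0" "map_poly cnj d \<noteq> 0"
    using x y by (simp_all add: map_poly_eq_0_iff)
  show "rat_cnj (x + y) = rat_cnj x + rat_cnj y"
    using x y nz by (simp add: rat_cnj_Fract map_poly_cnj_mult map_poly_cnj_add)
  show "rat_cnj (x * y) = rat_cnj x * rat_cnj y"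
    using x y by (simp add: rat_cnj_Fract map_poly_cnj_mult)
next
  show "rat_cnj 0 = 0" "rat_cnj 1 = 1"
    using rat_cnj_to_fract[of 0] rat_cnj_to_fract[of 1] by (simp_all add: map_poly_1 flip: one_pCons)
qed

text \<open>Horner's decomposition of \<open>pCons c p\<close> as
  \<open>[:c:] + [:0, 1:] * p\<close> reduces the claim to constants and the indeterminate, because
  all maps involved respect sums and products.\<close>

lemma rat_recip_poly_recip: "rat_recip (poly_recip p) = to_fract p"
proof (induction p)
  case (pCons c p)
  have *: "pCons c p = [:c:] + [:0, 1:] * p" by simp
  have "rat_recip (poly_recip (pCons c p)) =
      rat_recip (cst c) + rat_recip (inverse Z) * rat_recip (poly_recip p)"
    unfolding * poly_recip_add poly_recip_mult by (simp add: rat_recip.hom_add rat_recip.hom_mult)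
  also have "\<dots> = to_fract [:c:] + Z * to_fract p"
    unfolding cst_def pCons.IH by (simp add: rat_recip.hom_inverse cst_def)
  also have "\<dots> = to_fract (pCons c p)" unfolding * by (simp only: to_fract_add to_fract_mult)
  finally show ?case .
qed simp

lemma rat_recip_rat_recip [simp]: "rat_recip (rat_recip x) = x"
proof -
  obtain a b where x: "x = Fract a b" "b \<noteq> 0" by (cases x)
  show ?thesis
    using x by (simp add: rat_recip_Fract divide_inverse rat_recip.hom_mult rat_recip.hom_inverse rat_recip_poly_recip Fract_conv_to_fract)
qed

lemma poly_recip_map_cnj: "poly_recip (map_poly cnj p) = rat_cnj (poly_recip p)"
proof (induction p)
  case (pCons c p)
  have *: "pCons c p = [:c:] + [:0, 1:] * p" for c and p :: "complex poly" by simp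
  have "rat_cnj (poly_recip (pCons c p)) = rat_cnj (cst c) + rat_cnj (inverse Z) * rat_cnj (poly_recip p)"
    unfolding *[of c p] poly_recip_add poly_recip_mult by (simp add: rat_cnj.hom_add rat_cnj.hom_mult)
  also have "\<dots> = cst (cnj c) + inverse Z * poly_recip (map_poly cnj p)"
    unfolding pCons.IH by (simp add: rat_cnj.hom_inverse cst_def map_poly_pCons)
  also have "\<dots> = poly_recip (pCons (cnj c) (map_poly cnj p))"
    unfolding *[of "cnj c" "map_poly cnj p"] poly_recip_add poly_recip_mult by simp
  finally show ?case by (simp add: map_poly_pCons)
qed simp

lemma rat_recip_rat_cnj: "rat_recip (rat_cnj x) = rat_cnj (rat_recip x)"
proof -
  obtain a b where x: "x = Fract a b" "b \<noteq> 0" by (cases x)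
  have nz: "map_poly cnj b \<noteq> 0" using x by (simp add: map_poly_eq_0_iff)
  show ?thesis
    using x nz by (simp add: rat_recip_Fract rat_cnj_Fract divide_inverse rat_cnj.hom_mult rat_cnj.hom_inverse poly_recip_map_cnj)
qed

lemma rat_cnj_rat_cnj [simp]: "rat_cnj (rat_cnj x) = x"
proof -
  obtain a b where x: "x = Fract a b" "b \<noteq> 0" by (cases x)
  have nz: "map_poly cnj b \<noteq> 0" using x by (simp add: map_poly_eq_0_iff)
  show ?thesis
    using x nz by (simp add: rat_cnj_Fract map_poly_map_poly o_def)
qed

interpretation conj_recip: field_hom conj_recip
  by unfold_locales
    (simp_all add: conj_recip_def rat_recip.hom_add rat_cnj.hom_add rat_recip.hom_mult rat_cnj.hom_mult)

lemma conj_recip_conj_recip [simp]: "conj_recip (conj_recip x) = x"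
  by (simp add: conj_recip_def rat_recip_rat_cnj)

lemma conj_recip_cst [simp]: "conj_recip (cst c) = cst (cnj c)"
  by (simp add: conj_recip_def cst_def map_poly_pCons)

lemma conj_recip_Z [simp]: "conj_recip Z = inverse Z"
  by (simp add: conj_recip_def map_poly_pCons)

text \<open>This is the linear form that vanishes at the point (\<alpha> : \<beta>) of the
  projective line. For \<beta> = 0 the point is infinity and the form is a nonzero constant. As a
  nonzero scalar of C(z) it can be cancelled.\<close>

lemma pencil_root_nonzero: "(\<alpha>, \<beta>) \<noteq> (0, 0) \<Longrightarrow> Z * cst \<beta> - cst \<alpha> \<noteq> 0"
proof -
  assume *: "(\<alpha>, \<beta>) \<noteq> (0, 0)"
  have "Z * cst \<beta> - cst \<alpha> = to_fract ([:0, 1:] * [:\<beta>:] - [:\<alpha>:])"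
    unfolding cst_def by (simp only: to_fract_diff to_fract_mult)
  also have "[:0, 1:] * [:\<beta>:] - [:\<alpha>:] = [:-\<alpha>, \<beta>:]" by simp
  finally show ?thesis using * by auto
qed

section \<open>The involution on rational matrices\<close>

abbreviation cmat :: "complex mat \<Rightarrow> ratfun mat" where "cmat \<equiv> map_mat cst"

definition ctranspose :: "complex mat \<Rightarrow> complex mat" where
  "ctranspose K = transpose_mat (map_mat cnj K)"

definition adj :: "ratfun mat \<Rightarrow> ratfun mat" where
  "adj F = transpose_mat (map_mat conj_recip F)"

definition dag :: "ratfun mat \<Rightarrow> ratfun mat" where
  "dag F = Z \<cdot>\<^sub>m adj F"

text \<open>Translates the symmetry in the definitions of palindromic and anti-palindromic pencils
  into \<open>dag\<close>, for which the algebra below is developed.\<close>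

lemma rev1_mat_star: "rev1 (mat_star F) = dag F"
  by (intro eq_matI)
     (auto simp: rev1_def mat_star_def mat_recip_def dag_def adj_def conj_recip_def)

lemma ctranspose_carrier [simp]: "K \<in> carrier_mat r s \<Longrightarrow> ctranspose K \<in> carrier_mat s r"
  by (simp add: ctranspose_def)

lemma adj_carrier [simp]: "F \<in> carrier_mat r s \<Longrightarrow> adj F \<in> carrier_mat s r"
  by (simp add: adj_def)

lemma dag_carrier [simp]: "F \<in> carrier_mat r s \<Longrightarrow> dag F \<in> carrier_mat s r"
  by (simp add: dag_def)

lemma ctranspose_ctranspose [simp]: "ctranspose (ctranspose K) = K"
  by (intro eq_matI) (auto simp: ctranspose_def)

lemma adj_adj [simp]: "adj (adj F) = F"
  by (intro eq_matI) (auto simp: adj_def)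

lemma dag_dag [simp]: "dag (dag F) = F"
  by (intro eq_matI) (auto simp: adj_def dag_def conj_recip.hom_mult)

lemma ctranspose_mult:
  "F \<in> carrier_mat r n \<Longrightarrow> G \<in> carrier_mat n s \<Longrightarrow> ctranspose (F * G) = ctranspose G * ctranspose F"
  unfolding ctranspose_def
  by (intro eq_matI) (auto simp: scalar_prod_def mult.commute)

lemma adj_mult:
  "F \<in> carrier_mat r n \<Longrightarrow> G \<in> carrier_mat n s \<Longrightarrow> adj (F * G) = adj G * adj F"
  unfolding adj_def by (simp add: conj_recip.mat_hom_mult transpose_mult)

lemma adj_add:
  "F \<in> carrier_mat r s \<Longrightarrow> G \<in> carrier_mat r s \<Longrightarrow> adj (F + G) = adj F + adj G"
  by (intro eq_matI) (auto simp: adj_def conj_recip.hom_add)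

lemma dag_add:
  "F \<in> carrier_mat r s \<Longrightarrow> G \<in> carrier_mat r s \<Longrightarrow> dag (F + G) = dag F + dag G"
  by (intro eq_matI) (auto simp: adj_def dag_def conj_recip.hom_add distrib_left)

lemma dag_smult: "dag (c \<cdot>\<^sub>m F) = conj_recip c \<cdot>\<^sub>m dag F"
  by (intro eq_matI) (auto simp: adj_def dag_def conj_recip.hom_mult)

lemma adj_cmat [simp]: "adj (cmat K) = cmat (ctranspose K)"
  by (intro eq_matI) (auto simp: adj_def ctranspose_def)

lemma adj_one [simp]: "adj (1\<^sub>m n) = 1\<^sub>m n"
  by (intro eq_matI) (auto simp: adj_def)

lemma adj_zero [simp]: "adj (0\<^sub>m r s) = 0\<^sub>m s r"
  by (intro eq_matI) (auto simp: adj_def)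

lemma dag_zero [simp]: "dag (0\<^sub>m r s) = 0\<^sub>m s r"
  by (intro eq_matI) (auto simp: adj_def dag_def)

text \<open>\<open>adj\<close> reverses products, and the scalar z in \<open>dag\<close> can be
  attached to either factor. So for a pencil times a constant matrix, \<open>dag\<close> can act on
  the pencil and plain \<open>adj\<close> on the constant.\<close>

lemma dag_mult:
  assumes "F \<in> carrier_mat r n" "G \<in> carrier_mat n s"
  shows "dag (F * G) = adj G * dag F" and "dag (F * G) = dag G * adj F"
  using adj_carrier[OF assms(1)] adj_carrier[OF assms(2)]
  by (simp_all add: dag_def adj_mult[OF assms] mult_smult_distrib mult_smult_assoc_mat)

text \<open>The off-diagonal blocks trade places, so a system matrix is fixed by \<open>dag\<close>
  iff its diagonal blocks are fixed and \<open>dag\<close> exchanges B and C.\<close>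

lemma dag_four_block:
  assumes "A \<in> carrier_mat p q" "B \<in> carrier_mat p n" "C \<in> carrier_mat m q" "D \<in> carrier_mat m n"
  shows "dag (four_block_mat A B C D) = four_block_mat (dag A) (dag C) (dag B) (dag D)"
  using assms by (intro eq_matI) (auto simp: adj_def dag_def)

section \<open>Pencils as matrices over C(z)\<close>

definition pencil_entries :: "ratfun set" where
  "pencil_entries = {Z * cst a + cst b | a b. True}"

definition pencil_mats :: "nat \<Rightarrow> nat \<Rightarrow> ratfun mat set" where
  "pencil_mats r s = {F \<in> carrier_mat r s. \<forall>i<r. \<forall>j<s. F $$ (i, j) \<in> pencil_entries}"

lemma pencil_entriesI: "Z * cst a + cst b \<in> pencil_entries"
  by (auto simp: pencil_entries_def)

lemma cst_pencil_entry [simp]: "cst c \<in> pencil_entries"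
  using pencil_entriesI[of 0 c] by simp

lemma zero_pencil_entry [simp]: "0 \<in> pencil_entries"
  using cst_pencil_entry[of 0] by simp

lemma Z_pencil_entry [simp]: "Z \<in> pencil_entries"
  using pencil_entriesI[of 1 0] by simp

lemma add_pencil_entry: "x \<in> pencil_entries \<Longrightarrow> y \<in> pencil_entries \<Longrightarrow> x + y \<in> pencil_entries"
proof -
  assume "x \<in> pencil_entries" "y \<in> pencil_entries"
  then obtain a b c d where "x = Z * cst a + cst b" "y = Z * cst c + cst d"
    by (auto simp: pencil_entries_def)
  hence "x + y = Z * cst (a + c) + cst (b + d)" by (simp add: cst.hom_add algebra_simps)
  thus ?thesis by (simp add: pencil_entriesI)
qed

lemma smult_pencil_entry: "x \<in> pencil_entries \<Longrightarrow> cst c * x \<in> pencil_entries"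
proof -
  assume "x \<in> pencil_entries"
  then obtain a b where "x = Z * cst a + cst b"
    by (auto simp: pencil_entries_def)
  hence "cst c * x = Z * cst (c * a) + cst (c * b)" by (simp add: cst.hom_mult algebra_simps)
  thus ?thesis by (simp add: pencil_entriesI)
qed

lemma sum_pencil_entry: "(\<And>i. i \<in> I \<Longrightarrow> f i \<in> pencil_entries) \<Longrightarrow> sum f I \<in> pencil_entries"
  by (induction I rule: infinite_finite_induct) (auto intro: add_pencil_entry)

text \<open>The image of z a + b is z \<open>cnj b\<close> + \<open>cnj a\<close>: the two
  coefficients trade places and the degree stays at most one.\<close>

lemma conj_recip_pencil_entry: "x \<in> pencil_entries \<Longrightarrow> Z * conj_recip x \<in> pencil_entries"
proof -
  assume "x \<in> pencil_entries"
  then obtain a b where "x = Z * cst a + cst b"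
    by (auto simp: pencil_entries_def)
  hence "Z * conj_recip x = Z * cst (cnj b) + cst (cnj a)"
    by (simp add: conj_recip.hom_mult conj_recip.hom_add distrib_left)
  thus ?thesis by (simp add: pencil_entriesI)
qed

lemma pencil_mats_carrier: "F \<in> pencil_mats r s \<Longrightarrow> F \<in> carrier_mat r s"
  by (simp add: pencil_mats_def)

lemma cmat_pencil_mats [simp]: "K \<in> carrier_mat r s \<Longrightarrow> cmat K \<in> pencil_mats r s"
  by (auto simp: pencil_mats_def)

lemma zero_pencil_mats [simp]: "0\<^sub>m r s \<in> pencil_mats r s"
  by (auto simp: pencil_mats_def)

lemma add_pencil_mats: "F \<in> pencil_mats r s \<Longrightarrow> G \<in> pencil_mats r s \<Longrightarrow> F + G \<in> pencil_mats r s"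
  by (auto simp: pencil_mats_def intro!: add_pencil_entry)

lemma smult_pencil_mats: "F \<in> pencil_mats r s \<Longrightarrow> cst c \<cdot>\<^sub>m F \<in> pencil_mats r s"
  by (auto simp: pencil_mats_def intro!: smult_pencil_entry)

lemma dag_pencil_mats: "F \<in> pencil_mats r s \<Longrightarrow> dag F \<in> pencil_mats s r"
  by (auto simp: pencil_mats_def dag_def adj_def intro!: conj_recip_pencil_entry)

text \<open>Constant factors do not raise the degree. For this reason all changes of state
  coordinates below are made with constant matrices.\<close>

lemma cmat_mult_pencil_mats:
  "K \<in> carrier_mat r n \<Longrightarrow> F \<in> pencil_mats n s \<Longrightarrow> cmat K * F \<in> pencil_mats r s"
  by (auto simp: pencil_mats_def scalar_prod_def intro!: sum_pencil_entry smult_pencil_entry)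

lemma pencil_mats_mult_cmat:
  "F \<in> pencil_mats r n \<Longrightarrow> K \<in> carrier_mat n s \<Longrightarrow> F * cmat K \<in> pencil_mats r s"
  by (auto simp: pencil_mats_def scalar_prod_def mult.commute[of "_ $$ _" "cst _"]
      intro!: sum_pencil_entry smult_pencil_entry)

lemma four_block_pencil_mats:
  "A \<in> pencil_mats p q \<Longrightarrow> B \<in> pencil_mats p n \<Longrightarrow> C \<in> pencil_mats m q \<Longrightarrow> D \<in> pencil_mats m n \<Longrightarrow>
    four_block_mat A B C D \<in> pencil_mats (p + m) (q + n)"
  by (auto simp: pencil_mats_def)

lemma pencil_matsE:
  assumes "F \<in> pencil_mats r s"
  obtains F1 F0 where "F1 \<in> carrier_mat r s" "F0 \<in> carrier_mat r s"
    "F = Z \<cdot>\<^sub>m cmat F1 + cmat F0"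
proof -
  have "\<forall>i j. \<exists>a b. i < r \<longrightarrow> j < s \<longrightarrow> F $$ (i, j) = Z * cst a + cst b"
    using assms by (fastforce simp: pencil_mats_def pencil_entries_def)
  then obtain f g where fg: "i < r \<Longrightarrow> j < s \<Longrightarrow> F $$ (i, j) = Z * cst (f i j) + cst (g i j)" for i j
    by metis
  show ?thesis
  proof (rule that)
    show "F = Z \<cdot>\<^sub>m cmat (mat r s (\<lambda>(i, j). f i j)) + cmat (mat r s (\<lambda>(i, j). g i j))"
      using pencil_mats_carrier[OF assms] fg by (intro eq_matI) auto
  qed auto
qed

section \<open>Matrix algebra and ranks\<close>

text \<open>The library's algebraic laws for matrices in terms of dimensions, so that the simplifier
  can discharge the side conditions.\<close>

context
  fixes A B C :: "'a :: comm_ring_1 mat"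
begin

lemma mat_mult_assoc:
  "dim_col A = dim_row B \<Longrightarrow> dim_col B = dim_row C \<Longrightarrow> A * B * C = A * (B * C)"
  by (rule assoc_mult_mat) auto

lemma mat_mult_add:
  "dim_col A = dim_row B \<Longrightarrow> dim_row B = dim_row C \<Longrightarrow> dim_col B = dim_col C \<Longrightarrow>
    A * (B + C) = A * B + A * C"
  by (rule mult_add_distrib_mat) auto

lemma mat_add_mult:
  "dim_col B = dim_row C \<Longrightarrow> dim_row A = dim_row B \<Longrightarrow> dim_col A = dim_col B \<Longrightarrow>
    (A + B) * C = A * C + B * C"
  by (rule add_mult_distrib_mat) auto

lemma mat_mult_smult: "dim_col A = dim_row B \<Longrightarrow> A * (k \<cdot>\<^sub>m B) = k \<cdot>\<^sub>m (A * B)"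
  by (rule mult_smult_distrib) auto

lemma mat_smult_mult: "dim_col A = dim_row B \<Longrightarrow> k \<cdot>\<^sub>m A * B = k \<cdot>\<^sub>m (A * B)"
  by (rule mult_smult_assoc_mat) auto

lemma mat_smult_add:
  "dim_row A = dim_row B \<Longrightarrow> dim_col A = dim_col B \<Longrightarrow> k \<cdot>\<^sub>m (A + B) = k \<cdot>\<^sub>m A + k \<cdot>\<^sub>m B"
  by (rule add_smult_distrib_left_mat) auto

lemma mat_add_assoc:
  "dim_row A = dim_row B \<Longrightarrow> dim_col A = dim_col B \<Longrightarrow> dim_row B = dim_row C \<Longrightarrow>
    dim_col B = dim_col C \<Longrightarrow> A + B + C = A + (B + C)"
  by (rule assoc_add_mat) auto

lemma mat_add_commute:
  "dim_row A = dim_row B \<Longrightarrow> dim_col A = dim_col B \<Longrightarrow> A + B = B + A"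
  by (rule comm_add_mat) auto

lemma mat_zero_mult: "dim_row A = s \<Longrightarrow> 0\<^sub>m r s * A = 0\<^sub>m r (dim_col A)"
  by (rule left_mult_zero_mat) auto

lemma mat_mult_zero: "dim_col A = r \<Longrightarrow> A * 0\<^sub>m r s = 0\<^sub>m (dim_row A) s"
  by (rule right_mult_zero_mat) auto

lemma mat_add_zero: "dim_row A = r \<Longrightarrow> dim_col A = s \<Longrightarrow> A + 0\<^sub>m r s = A"
  by (intro eq_matI) auto

lemma mat_zero_add: "dim_row A = r \<Longrightarrow> dim_col A = s \<Longrightarrow> 0\<^sub>m r s + A = A"
  by (intro eq_matI) auto

lemma mat_mult_one: "dim_col A = n \<Longrightarrow> A * 1\<^sub>m n = A"
  by (rule right_mult_one_mat) auto

lemma mat_one_mult: "dim_row A = n \<Longrightarrow> 1\<^sub>m n * A = A"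
  by (rule left_mult_one_mat) auto

end

lemma mat_add_left_commute:
  fixes A B C :: "'a :: comm_ring_1 mat"
  shows "dim_row A = dim_row B \<Longrightarrow> dim_col A = dim_col B \<Longrightarrow> dim_row B = dim_row C \<Longrightarrow>
    dim_col B = dim_col C \<Longrightarrow> A + (B + C) = B + (A + C)"
  by (metis mat_add_assoc mat_add_commute)

lemma mat_smult_smult: "a \<cdot>\<^sub>m (b \<cdot>\<^sub>m A) = (a * b :: 'a :: comm_ring_1) \<cdot>\<^sub>m A"
  by (intro eq_matI) (auto simp: mult.assoc)

lemma mat_one_smult: "(1 :: 'a :: comm_ring_1) \<cdot>\<^sub>m A = A"
  by (intro eq_matI) auto

lemmas mat_ring = mat_mult_assoc mat_mult_add mat_add_mult mat_mult_smult mat_smult_mult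
  mat_smult_add mat_add_assoc mat_zero_mult mat_mult_zero mat_add_zero mat_zero_add
  mat_mult_one mat_one_mult

lemmas mat_add_ac = mat_add_assoc mat_add_commute mat_add_left_commute

lemma dim_adj [simp]: "dim_row (adj F) = dim_col F" "dim_col (adj F) = dim_row F"
  and dim_dag [simp]: "dim_row (dag F) = dim_col F" "dim_col (dag F) = dim_row F"
  and dim_ctranspose [simp]: "dim_row (ctranspose K) = dim_col K" "dim_col (ctranspose K) = dim_row K"
  by (simp_all add: adj_def dag_def ctranspose_def)

lemma adj_mult': "dim_col F = dim_row G \<Longrightarrow> adj (F * G) = adj G * adj F"
  by (rule adj_mult) auto

lemma ctranspose_mult': "dim_col F = dim_row G \<Longrightarrow> ctranspose (F * G) = ctranspose G * ctranspose F"
  by (rule ctranspose_mult) auto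

lemma cmat_mult: "dim_col F = dim_row G \<Longrightarrow> cmat (F * G) = cmat F * cmat G"
  by (rule cst.mat_hom_mult) auto

lemma cmat_add: "dim_row F = dim_row G \<Longrightarrow> dim_col F = dim_col G \<Longrightarrow> cmat (F + G) = cmat F + cmat G"
  by (intro eq_matI) (auto simp: cst.hom_add)

lemma cmat_zero [simp]: "cmat (0\<^sub>m r s) = 0\<^sub>m r s" and cmat_one [simp]: "cmat (1\<^sub>m n) = 1\<^sub>m n"
  by (auto intro!: eq_matI)

lemma cmat_inj: "cmat F = cmat G \<Longrightarrow> F = G"
  by (rule cst.mat_hom_inj)

section \<open>Cancellation, kernels and ranks over a field\<close>

lemma mat_smult_cancel: "k \<noteq> 0 \<Longrightarrow> k \<cdot>\<^sub>m F = k \<cdot>\<^sub>m G \<Longrightarrow> F = (G :: 'a :: field mat)"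
proof -
  assume k: "k \<noteq> 0" and *: "k \<cdot>\<^sub>m F = k \<cdot>\<^sub>m G"
  have "inverse k \<cdot>\<^sub>m (k \<cdot>\<^sub>m F) = inverse k \<cdot>\<^sub>m (k \<cdot>\<^sub>m G)" by (simp add: *)
  with k show ?thesis by (simp add: mat_smult_smult mat_one_smult)
qed

text \<open>Vectors are represented by one-column matrices, so that kernel arguments are carried out
  with matrix identities alone. The proof converts to the vector form of the kernel
  criterion.\<close>

lemma det_nonzeroI:
  fixes A :: "'a :: field mat"
  assumes A: "A \<in> carrier_mat n n"
    and ker: "\<And>V. V \<in> carrier_mat n 1 \<Longrightarrow> A * V = 0\<^sub>m n 1 \<Longrightarrow> V = 0\<^sub>m n 1"
  shows "det A \<noteq> 0"
proof
  assume "det A = 0"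
  then obtain v where v: "v \<in> carrier_vec n" "v \<noteq> 0\<^sub>v n" "A *\<^sub>v v = 0\<^sub>v n"
    using det_0_iff_vec_prod_zero_field[OF A] by auto
  define V where "V = mat n 1 (\<lambda>(i, j). v $ i)"
  have V: "V \<in> carrier_mat n 1" and col: "col V 0 = v" using v(1) by (auto simp: V_def)
  have "A * V = 0\<^sub>m n 1"
  proof (rule eq_matI)
    fix i j assume "i < dim_row (0\<^sub>m n 1 :: 'a mat)" "j < dim_col (0\<^sub>m n 1 :: 'a mat)"
    hence ij: "i < n" "j = 0" by auto
    have "(A * V) $$ (i, j) = (A *\<^sub>v v) $ i" using A V ij col by simp
    thus "(A * V) $$ (i, j) = 0\<^sub>m n 1 $$ (i, j)" using v(3) ij by simp
  qed (use A V in auto)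
  hence "V = 0\<^sub>m n 1" by (rule ker[OF V])
  hence "v = 0\<^sub>v n" using col by auto
  with v(2) show False by simp
qed

lemma mat_inverse_exists:
  fixes A :: "'a :: field mat"
  assumes A: "A \<in> carrier_mat n n" and "det A \<noteq> 0"
  obtains N where "N \<in> carrier_mat n n" "A * N = 1\<^sub>m n" "N * A = 1\<^sub>m n"
  using det_non_zero_imp_unit[OF assms, of "()"] that
  by (auto simp: Units_def ring_mat_def)

text \<open>A trivial kernel means that the columns are linearly independent, so the rank is their
  number.\<close>

lemma full_col_rankI:
  assumes M: "M \<in> carrier_mat r s"
    and ker: "\<And>x. x \<in> carrier_mat s 1 \<Longrightarrow> M * x = 0\<^sub>m r 1 \<Longrightarrow> x = 0\<^sub>m s 1"
  shows "full_col_rank M"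
proof -
  have kerv: "v = 0\<^sub>v s" if v: "v \<in> carrier_vec s" "M *\<^sub>v v = 0\<^sub>v r" for v
  proof -
    define V where "V = mat s 1 (\<lambda>(i, j). v $ i)"
    have V: "V \<in> carrier_mat s 1" and col: "col V 0 = v" using v(1) by (auto simp: V_def)
    have "M * V = 0\<^sub>m r 1"
    proof (rule eq_matI)
      fix i j assume "i < dim_row (0\<^sub>m r 1 :: complex mat)" "j < dim_col (0\<^sub>m r 1 :: complex mat)"
      hence ij: "i < r" "j = 0" by auto
      have "(M * V) $$ (i, j) = (M *\<^sub>v v) $ i" using M V ij col by simp
      thus "(M * V) $$ (i, j) = 0\<^sub>m r 1 $$ (i, j)" using v(2) ij by simp
    qed (use M V in auto)
    hence "V = 0\<^sub>m s 1" by (rule ker[OF V])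
    thus "v = 0\<^sub>v s" using col by auto
  qed
  interpret vec_space "TYPE(complex)" r .
  \<comment> \<open>Linear independence speaks of the set of columns, so repetitions must be
    excluded first: two equal columns i and j would put the difference of the unit vectors i and j
    into the kernel.\<close>
  have distinct: "distinct (cols M)"
  proof (rule ccontr)
    assume "\<not> distinct (cols M)"
    then obtain i j where ij: "i < s" "j < s" "i \<noteq> j" "col M i = col M j"
      using M by (auto simp: distinct_conv_nth)
    have Mu: "M *\<^sub>v unit_vec s k = col M k" if "k < s" for k
      using M that by (intro eq_vecI) auto
    have "M *\<^sub>v (unit_vec s i - unit_vec s j) = M *\<^sub>v unit_vec s i - M *\<^sub>v unit_vec s j"
      by (rule mult_minus_distrib_mat_vec[OF M]) auto
    also have "\<dots> = 0\<^sub>v r"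
      using ij M by (simp add: Mu)
    finally have "unit_vec s i - unit_vec s j = (0\<^sub>v s :: complex vec)" by (intro kerv) auto
    from arg_cong[OF this, of "\<lambda>v. vec_index v i"] ij show False by simp
  qed
  have "lin_indpt (set (cols M))"
  proof
    assume "lin_dep (set (cols M))"
    from lin_depE[OF M this distinct] kerv show False by metis
  qed
  hence "rank M = s" by (rule lin_indpt_full_rank[OF M distinct])
  thus ?thesis using M by (simp add: full_col_rank_def)
qed

text \<open>The single entry of the product is the sum of the squared moduli of the entries of
  \<open>W\<close>.\<close>

lemma ctranspose_mult_self_eq_0:
  assumes "ctranspose W * W = 0\<^sub>m 1 1" "W \<in> carrier_mat n 1"
  shows "W = 0\<^sub>m n 1"
proof (rule eq_matI)
  define S where "S = (\<Sum>i<n. (cmod (W $$ (i, 0)))\<^sup>2)"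
  have "(ctranspose W * W) $$ (0, 0) = (\<Sum>i<n. cnj (W $$ (i, 0)) * W $$ (i, 0))"
    using assms(2) by (auto simp: ctranspose_def scalar_prod_def atLeast0LessThan intro!: sum.cong)
  also have "\<dots> = of_real S" unfolding S_def of_real_sum
    by (intro sum.cong refl) (simp only: complex_norm_square mult.commute)
  finally have "S = 0" using assms(1) by simp
  hence "\<forall>i\<in>{..<n}. (cmod (W $$ (i, 0)))\<^sup>2 = 0"
    unfolding S_def by (rule sum_nonneg_eq_0_iff[THEN iffD1, rotated 2]) simp_all
  hence "\<forall>i<n. W $$ (i, 0) = 0" by simp
  thus "W $$ (i, j) = 0\<^sub>m n 1 $$ (i, j)" if "i < dim_row (0\<^sub>m n 1 :: complex mat)"
    "j < dim_col (0\<^sub>m n 1 :: complex mat)" for i j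
    using that by simp
qed (use assms in auto)

text \<open>The Gram matrix \<open>M * ctranspose M\<close> is invertible: if it kills V, then
  \<open>ctranspose M * V\<close> has norm zero, so \<open>ctranspose V\<close> is a left null
  vector of M. Its inverse provides a right inverse of M, so the columns of M span the whole
  space.\<close>

lemma full_row_rankI:
  assumes M: "M \<in> carrier_mat r s"
    and ker: "\<And>x. x \<in> carrier_mat 1 r \<Longrightarrow> x * M = 0\<^sub>m 1 s \<Longrightarrow> x = 0\<^sub>m 1 r"
  shows "full_row_rank M"
proof -
  note [simp] = carrier_matD[OF M]
  have "det (M * ctranspose M) \<noteq> 0"
  proof (rule det_nonzeroI)
    fix V assume V: "V \<in> carrier_mat r 1" and 0: "M * ctranspose M * V = 0\<^sub>m r 1"
    note [simp] = carrier_matD[OF V]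
    define W where "W = ctranspose M * V"
    have [simp]: "dim_row W = s" "dim_col W = 1" by (simp_all add: W_def)
    have "ctranspose W * W = ctranspose V * (M * ctranspose M * V)"
      by (simp add: W_def ctranspose_mult' mat_mult_assoc)
    also have "\<dots> = 0\<^sub>m 1 1" unfolding 0 by (subst mat_mult_zero) simp_all
    finally have "W = 0\<^sub>m s 1" by (rule ctranspose_mult_self_eq_0) (rule carrier_matI, simp_all)
    moreover have "ctranspose V * M = ctranspose W" by (simp add: W_def ctranspose_mult')
    ultimately have "ctranspose V * M = ctranspose (0\<^sub>m s 1)" by simp
    also have "\<dots> = 0\<^sub>m 1 s" by (intro eq_matI) (auto simp: ctranspose_def)
    finally have "ctranspose V = 0\<^sub>m 1 r" using V by (intro ker) auto
    hence "ctranspose (ctranspose V) = ctranspose (0\<^sub>m 1 r)" by simp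
    also have "\<dots> = 0\<^sub>m r 1" by (intro eq_matI) (auto simp: ctranspose_def)
    finally show "V = 0\<^sub>m r 1" by simp
  qed (use M in auto)
  then obtain N where N: "N \<in> carrier_mat r r" "M * ctranspose M * N = 1\<^sub>m r"
    using M by (elim mat_inverse_exists[rotated]) auto
  note [simp] = carrier_matD[OF N(1)]
  interpret vec_space "TYPE(complex)" r .
  have "span (set (cols M)) = carrier_vec r"
  proof
    show "span (set (cols M)) \<subseteq> carrier_vec r"
      using M by (intro span_is_subset2) (use cols_dim[of M] in auto)
    show "carrier_vec r \<subseteq> span (set (cols M))"
    proof
      fix v :: "complex vec" assume v: "v \<in> carrier_vec r"
      have "M *\<^sub>v ((ctranspose M * N) *\<^sub>v v) = (M * (ctranspose M * N)) *\<^sub>v v"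
        by (rule assoc_mult_mat_vec[symmetric, OF M _ v, of _ ]) (rule carrier_matI; simp)
      also have "\<dots> = v" using N(2) v by (simp flip: mat_mult_assoc)
      finally have *: "M *\<^sub>v ((ctranspose M * N) *\<^sub>v v) = v" .
      have "(ctranspose M * N) *\<^sub>v v \<in> carrier_vec s"
        by (rule mult_mat_vec_carrier[OF carrier_matI v]) simp_all
      with * v have "\<exists>x\<in>carrier_vec s. M *\<^sub>v x = v" by blast
      with v have "v \<in> col_space M" unfolding col_space_eq[OF M] by simp
      thus "v \<in> span (set (cols M))" by (simp add: col_space_def)
    qed
  qed
  hence "rank M = vectorspace.dim class_ring (vs (carrier_vec r))" by (simp only: rank_def)
  also have "vs (carrier_vec r) = V" by (simp add: module_vec_def)
  finally have "rank M = r" by (simp only: dim_is_n)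
  thus ?thesis using M by (simp add: full_row_rank_def)
qed

section \<open>Splitting off vectors\<close>

text \<open>Isolates a pivot index j: \<open>insert_index j\<close> enumerates the remaining indices
  in increasing order.\<close>

lemma sum_insert_index:
  fixes g :: "nat \<Rightarrow> 'a :: comm_monoid_add"
  assumes "j < p"
  shows "(\<Sum>l<p. g l) = g j + (\<Sum>i<p-1. g (insert_index j i))"
proof -
  have *: "insert_index j ` {..<p-1} = {..<p} - {j}"
    using insert_index_image[of j "p - 1"] assms by (simp add: atLeast0LessThan)
  have "(\<Sum>i<p-1. g (insert_index j i)) = (\<Sum>l\<in>{..<p} - {j}. g l)"
    unfolding *[symmetric] by (rule sum.reindex[symmetric, unfolded o_def]) (rule insert_index_inj_on)
  thus ?thesis using assms by (simp add: sum.remove)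
qed

lemma insert_index_eq_iff [simp]: "insert_index j i = insert_index j k \<longleftrightarrow> i = k"
  using insert_index_inj_on[of j UNIV] by (auto dest: injD)

lemma insert_index_neq' [simp]: "j \<noteq> insert_index j i"
  using insert_index_exclude[of j i] by metis

lemma insert_index_cases:
  assumes "l < (p::nat)" "j < p"
  obtains "l = j" | i where "i < p - 1" "l = insert_index j i"
proof (cases "l = j")
  case False
  with assms have "l \<in> insert_index j ` {0..<p - 1}" using insert_index_image[of j "p - 1"] by simp
  thus ?thesis using that(2) by auto
qed (use that in auto)

lemma insert_index_less: "i < p - 1 \<Longrightarrow> insert_index j i < p"
  by (auto simp: insert_index_def)

lemma mult_mat_index:
  "A \<in> carrier_mat r n \<Longrightarrow> B \<in> carrier_mat n s \<Longrightarrow> i < r \<Longrightarrow> j < s \<Longrightarrow>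
    (A * B) $$ (i, j) = (\<Sum>k<n. A $$ (i, k) * B $$ (k, j))"
  by (auto simp: scalar_prod_def atLeast0LessThan)

text \<open>Splits off the projection \<open>u b\<close> onto the line spanned by \<open>u\<close>.\<close>

lemma split_off_projection:
  fixes u b :: "'a :: field mat"
  assumes u: "u \<in> carrier_mat p 1" and b: "b \<in> carrier_mat 1 p" and bu: "b * u = 1\<^sub>m 1"
  obtains K N where "K \<in> carrier_mat p (p - 1)" "N \<in> carrier_mat (p - 1) p"
    "1\<^sub>m p = K * N + u * b" "N * K = 1\<^sub>m (p - 1)" "b * K = 0\<^sub>m 1 (p - 1)" "N * u = 0\<^sub>m (p - 1) 1"
    "p \<noteq> 0"
proof -
  note One_nat_def [simp del]
  define U where "U l = u $$ (l, 0)" for l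
  define V where "V l = b $$ (0, l)" for l
  have sum1: "(\<Sum>l<p. V l * U l) = 1"
    using arg_cong[OF bu, of "\<lambda>A. A $$ (0, 0)"] mult_mat_index[OF b u, of 0 0]
    by (simp add: U_def V_def)
  \<comment> \<open>Since b u = 1, some coordinate of u is nonzero; it serves as the pivot.\<close>
  then obtain j where j: "j < p" "U j \<noteq> 0"
    by (metis (no_types, lifting) lessThan_iff mult_zero_right sum.neutral zero_neq_one)
  define f where "f = insert_index j"
  have [simp]: "f i = f k \<longleftrightarrow> i = k" "f i \<noteq> j" "j \<noteq> f i" for i k
    by (simp_all add: f_def)
  have fless: "f i < p" if "i < p - 1" for i
    using insert_index_less[OF that] by (simp add: f_def)
  have sumf: "(\<Sum>l<p. g l) = g j + (\<Sum>i<p-1. g (f i))" for g :: "nat \<Rightarrow> 'a"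
    unfolding f_def by (rule sum_insert_index[OF j(1)])
  have sum2: "(\<Sum>i<p-1. V (f i) * U (f i)) = 1 - V j * U j"
    using sum1 unfolding sumf[of "\<lambda>l. V l * U l"] by (simp add: algebra_simps)
  \<comment> \<open>\<open>N\<close> subtracts the multiple of u that clears coordinate j and then
    drops that coordinate, so it kills u. The columns of \<open>K\<close> are the images under 1 - u
    b of the unit vectors other than number j, so b kills them.\<close>
  define N where "N = mat (p - 1) p
    (\<lambda>(i, l). (if l = f i then 1 else 0) - (if l = j then U (f i) / U j else 0))"
  define K where "K = mat p (p - 1) (\<lambda>(l, i). (if l = f i then 1 else 0) - U l * V (f i))"
  have N: "N \<in> carrier_mat (p - 1) p" and K: "K \<in> carrier_mat p (p - 1)"
    by (simp_all add: N_def K_def)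
  have Nj: "N $$ (i, j) = - U (f i) / U j" if "i < p - 1" for i
    using that j by (simp add: N_def)
  have Nf: "N $$ (i, f k) = (if k = i then 1 else 0)" if "i < p - 1" "k < p - 1" for i k
    using that fless by (auto simp: N_def)
  have Kj: "K $$ (j, i) = - U j * V (f i)" if "i < p - 1" for i
    using that j by (simp add: K_def)
  have Kf: "K $$ (f k, i) = (if k = i then 1 else 0) - U (f k) * V (f i)" if "i < p - 1" "k < p - 1" for i k
    using that fless by (auto simp: K_def)
  have NK: "N * K = 1\<^sub>m (p - 1)"
  proof (rule eq_matI)
    fix i k assume "i < dim_row (1\<^sub>m (p - 1) :: 'a mat)" "k < dim_col (1\<^sub>m (p - 1) :: 'a mat)"
    hence ik: "i < p - 1" "k < p - 1" by auto
    have "(N * K) $$ (i, k) = (\<Sum>l<p. N $$ (i, l) * K $$ (l, k))"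
      by (rule mult_mat_index[OF N K ik])
    also have "\<dots> = U (f i) * V (f k) + (\<Sum>l<p-1. (if l = i then 1 else 0) * K $$ (f l, k))"
      unfolding sumf using ik j
      by (intro arg_cong2[of _ _ _ _ "(+)"] sum.cong) (auto simp: Nj Kj Nf)
    also have "\<dots> = 1\<^sub>m (p - 1) $$ (i, k)"
      using ik by (simp add: if_distrib[of "\<lambda>x. x * _"] sum.delta Kf cong: if_cong)
    finally show "(N * K) $$ (i, k) = 1\<^sub>m (p - 1) $$ (i, k)" .
  qed (use N K in auto)
  have bK: "b * K = 0\<^sub>m 1 (p - 1)"
  proof (rule eq_matI)
    fix i k assume "i < dim_row (0\<^sub>m 1 (p - 1) :: 'a mat)" "k < dim_col (0\<^sub>m 1 (p - 1) :: 'a mat)"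
    hence ik: "i = 0" "k < p - 1" by auto
    have "(b * K) $$ (0, k) = (\<Sum>l<p. V l * K $$ (l, k))"
      unfolding V_def by (rule mult_mat_index[OF b K]) (use ik in auto)
    also have "\<dots> = - V j * U j * V (f k) +
        (\<Sum>l<p-1. V (f l) * ((if l = k then 1 else 0) - U (f l) * V (f k)))"
      unfolding sumf using ik j
      by (intro arg_cong2[of _ _ _ _ "(+)"] sum.cong) (auto simp: Kj Kf)
    also have "(\<Sum>l<p-1. V (f l) * ((if l = k then 1 else 0) - U (f l) * V (f k))) =
        (\<Sum>l<p-1. (if l = k then V (f l) else 0) - V (f l) * U (f l) * V (f k))"
      by (intro sum.cong) (auto simp: algebra_simps)
    also have "\<dots> = V (f k) - (1 - V j * U j) * V (f k)"
      using ik by (simp add: sum_subtractf sum2 flip: sum_distrib_right)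
    finally show "(b * K) $$ (i, k) = 0\<^sub>m 1 (p - 1) $$ (i, k)"
      using ik by (simp add: algebra_simps)
  qed (use b K in auto)
  have Nu: "N * u = 0\<^sub>m (p - 1) 1"
  proof (rule eq_matI)
    fix i k assume "i < dim_row (0\<^sub>m (p - 1) 1 :: 'a mat)" "k < dim_col (0\<^sub>m (p - 1) 1 :: 'a mat)"
    hence ik: "i < p - 1" "k = 0" by auto
    have "(N * u) $$ (i, 0) = (\<Sum>l<p. N $$ (i, l) * U l)"
      unfolding U_def by (rule mult_mat_index[OF N u]) (use ik in auto)
    also have "\<dots> = - U (f i) + (\<Sum>l<p-1. if l = i then U (f l) else 0)"
      unfolding sumf using ik j
      by (intro arg_cong2[of _ _ _ _ "(+)"] sum.cong) (auto simp: Nj Nf)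
    finally show "(N * u) $$ (i, k) = 0\<^sub>m (p - 1) 1 $$ (i, k)" using ik by simp
  qed (use N u in auto)
  have one: "1\<^sub>m p = K * N + u * b"
  proof (rule eq_matI)
    fix l l' assume "l < dim_row (K * N + u * b)" "l' < dim_col (K * N + u * b)"
    hence ll: "l < p" "l' < p" using u b by auto
    have "(K * N + u * b) $$ (l, l') = (\<Sum>i<p-1. K $$ (l, i) * N $$ (i, l')) + U l * V l'"
      using ll u b N K mult_mat_index[OF K N ll] mult_mat_index[OF u b ll]
      by (simp add: U_def V_def One_nat_def)
    also have "(\<Sum>i<p-1. K $$ (l, i) * N $$ (i, l')) = (if l = l' then 1 else 0) - U l * V l'"
      using ll(2) j(1)
    proof (cases rule: insert_index_cases)
      case (2 k)
      hence k: "k < p - 1" "l' = f k" by (simp_all add: f_def)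
      have "(\<Sum>i<p-1. K $$ (l, i) * N $$ (i, l')) = (\<Sum>i<p-1. if i = k then K $$ (l, i) else 0)"
        using k by (intro sum.cong) (auto simp: Nf)
      thus ?thesis using k ll by (simp add: K_def)
    next
      case 1
      have "(\<Sum>i<p-1. K $$ (l, i) * N $$ (i, l')) =
          - (\<Sum>i<p-1. (if l = f i then U l else 0) - U l * (V (f i) * U (f i))) / U j"
        unfolding sum_negf[symmetric] sum_divide_distrib using 1 ll j
        by (intro sum.cong) (auto simp: Nj K_def field_simps)
      also have "(\<Sum>i<p-1. (if l = f i then U l else 0) - U l * (V (f i) * U (f i))) =
          (\<Sum>i<p-1. if l = f i then U l else 0) - U l * (1 - V j * U j)"
        by (simp add: sum_subtractf sum2 flip: sum_distrib_left)
      also have "(\<Sum>i<p-1. if l = f i then U l else 0) = (if l = j then 0 else U l)"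
        using ll(1) j(1)
      proof (cases rule: insert_index_cases)
        case (2 k)
        hence "l = f k" "k < p - 1" by (simp_all add: f_def)
        thus ?thesis by (simp add: eq_commute[of k])
      qed simp
      finally have *: "(\<Sum>i<p-1. K $$ (l, i) * N $$ (i, l')) =
          - ((if l = j then 0 else U l) - U l * (1 - V j * U j)) / U j" .
      show ?thesis unfolding * using 1 j by (cases "l = j") (simp_all add: field_simps)
    qed
    finally show "1\<^sub>m p $$ (l, l') = (K * N + u * b) $$ (l, l')" using ll by simp
  qed (use u b in auto)
  show ?thesis using that[OF K N one NK bK Nu] j by auto
qed

lemma left_inverse_of_nonzero_column:
  fixes x :: "'a :: field mat"
  assumes x: "x \<in> carrier_mat p 1" and nz: "x \<noteq> 0\<^sub>m p 1"
  obtains b where "b \<in> carrier_mat 1 p" "b * x = 1\<^sub>m 1"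
proof -
  obtain i where i: "i < p" "x $$ (i, 0) \<noteq> 0"
  proof (rule ccontr)
    assume "\<not> thesis"
    with that have "x $$ (i, 0) = 0" if "i < p" for i using that by blast
    hence "x = 0\<^sub>m p 1" using x by (intro eq_matI) auto
    with nz show False by simp
  qed
  define b where "b = mat 1 p (\<lambda>(r, l). if l = i then inverse (x $$ (i, 0)) else 0)"
  have b: "b \<in> carrier_mat 1 p" by (simp add: b_def)
  have "b * x = 1\<^sub>m 1"
  proof (rule eq_matI)
    fix r s assume "r < dim_row (1\<^sub>m 1 :: 'a mat)" "s < dim_col (1\<^sub>m 1 :: 'a mat)"
    hence rs: "r = 0" "s = 0" by auto
    have "(b * x) $$ (0, 0) = (\<Sum>l<p. b $$ (0, l) * x $$ (l, 0))"
      by (rule mult_mat_index[OF b x]) auto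
    also have "\<dots> = (\<Sum>l<p. if l = i then 1 else 0)"
      using i by (intro sum.cong) (auto simp: b_def)
    finally show "(b * x) $$ (r, s) = 1\<^sub>m 1 $$ (r, s)" using rs i by simp
  qed (use b x in auto)
  with b show ?thesis by (rule that)
qed

text \<open>If \<open>a\<^sup>* x \<noteq> 0\<close>, the columns of \<open>K\<close> are a basis of the orthogonal complement of \<open>a\<close>; otherwise
  \<open>x\<close> lies in that complement, and they span a complement of \<open>x\<close> in it.\<close>

lemma split_off_pair:
  assumes x: "x \<in> carrier_mat p 1" "x \<noteq> 0\<^sub>m p 1" and a: "a \<in> carrier_mat p 1" "a \<noteq> 0\<^sub>m p 1"
  obtains q K N h y where "q < p" "K \<in> carrier_mat p q" "N \<in> carrier_mat q p"
    "h \<in> carrier_mat 1 p" "y \<in> carrier_mat p 1"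
    "1\<^sub>m p = K * N + x * h + y * ctranspose a"
    "ctranspose a * K = 0\<^sub>m 1 q" "N * K = 1\<^sub>m q" "N * x = 0\<^sub>m q 1"
proof (cases "ctranspose a * x = 0\<^sub>m 1 1")
  case False
  note [simp] = carrier_matD[OF x(1)] carrier_matD[OF a(1)]
  define c where "c = (ctranspose a * x) $$ (0, 0)"
  have ax: "ctranspose a * x = c \<cdot>\<^sub>m 1\<^sub>m 1"
    by (intro eq_matI) (auto simp: c_def)
  with False have c: "c \<noteq> 0" by auto
  \<comment> \<open>The functional \<open>ctranspose a\<close>, divided by c, takes the value 1 at
    x. Splitting off x along this functional leaves exactly its kernel, the orthogonal complement of
    a.\<close>
  have "inverse c \<cdot>\<^sub>m ctranspose a * x = 1\<^sub>m 1"
    using c by (simp add: mat_smult_mult ax mat_smult_smult mat_one_smult)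
  then obtain K N where KN: "K \<in> carrier_mat p (p - 1)" "N \<in> carrier_mat (p - 1) p"
    "1\<^sub>m p = K * N + x * (inverse c \<cdot>\<^sub>m ctranspose a)" "N * K = 1\<^sub>m (p - 1)"
    "inverse c \<cdot>\<^sub>m ctranspose a * K = 0\<^sub>m 1 (p - 1)" "N * x = 0\<^sub>m (p - 1) 1" "p \<noteq> 0"
    using a(1) x(1) by (elim split_off_projection[rotated 2]) auto
  note [simp] = carrier_matD[OF KN(1)] carrier_matD[OF KN(2)]
  show ?thesis
  \<comment> \<open>A single direction is split off here. It is entered as the y-term, with h = 0,
    and the factor 1/c moves from the functional to the vector.\<close>
  proof (rule that[of "p - 1" K N "0\<^sub>m 1 p" "inverse c \<cdot>\<^sub>m x"])
    show "1\<^sub>m p = K * N + x * 0\<^sub>m 1 p + inverse c \<cdot>\<^sub>m x * ctranspose a"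
      by (subst KN(3)) (simp add: mat_ring)
    have "inverse c \<cdot>\<^sub>m (ctranspose a * K) = inverse c \<cdot>\<^sub>m 0\<^sub>m 1 (p - 1)"
      using KN(5) by (simp add: mat_smult_mult)
    thus "ctranspose a * K = 0\<^sub>m 1 (p - 1)" using c by (elim mat_smult_cancel[rotated]) auto
  qed (use KN x in auto)
next
  case True
  note [simp] = carrier_matD[OF x(1)] carrier_matD[OF a(1)]
  obtain b where b: "b \<in> carrier_mat 1 p" "b * a = 1\<^sub>m 1"
    using left_inverse_of_nonzero_column[OF a] .
  note [simp] = carrier_matD[OF b(1)]
  \<comment> \<open>The vector y is dual to a, so splitting it off first gives coordinates
    \<open>K1\<close>, \<open>N1\<close> on the orthogonal complement of a.\<close>
  define y where "y = ctranspose b"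
  have y: "y \<in> carrier_mat p 1" using b by (simp add: y_def)
  note [simp] = carrier_matD[OF y]
  have "ctranspose a * y = ctranspose (b * a)" by (simp add: ctranspose_mult' y_def)
  also have "\<dots> = 1\<^sub>m 1" unfolding b by (intro eq_matI) (auto simp: ctranspose_def)
  finally obtain K1 N1 where 1: "K1 \<in> carrier_mat p (p - 1)" "N1 \<in> carrier_mat (p - 1) p"
    "1\<^sub>m p = K1 * N1 + y * ctranspose a" "N1 * K1 = 1\<^sub>m (p - 1)"
    "ctranspose a * K1 = 0\<^sub>m 1 (p - 1)" "N1 * y = 0\<^sub>m (p - 1) 1" "p \<noteq> 0"
    using a(1) y by (elim split_off_projection[rotated 2]) auto
  note [simp] = carrier_matD[OF 1(1)] carrier_matD[OF 1(2)]
  \<comment> \<open>In this case x lies in the orthogonal complement of a, and N1 x is its nonzero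
    coordinate vector there. A second splitting, now in dimension p - 1, removes that
    vector.\<close>
  have xeq: "x = K1 * (N1 * x)"
  proof -
    have "x = (K1 * N1 + y * ctranspose a) * x" using x(1) by (simp flip: 1(3))
    also have "\<dots> = K1 * (N1 * x)" by (simp add: mat_ring True)
    finally show ?thesis .
  qed
  have "N1 * x \<noteq> 0\<^sub>m (p - 1) 1"
    using xeq x(2) by (auto simp: mat_mult_zero)
  moreover have N1x: "N1 * x \<in> carrier_mat (p - 1) 1" by (rule carrier_matI; simp)
  ultimately obtain h where h: "h \<in> carrier_mat 1 (p - 1)" "h * (N1 * x) = 1\<^sub>m 1"
    using left_inverse_of_nonzero_column by blast
  note [simp] = carrier_matD[OF h(1)]
  obtain K2 N2 where 2: "K2 \<in> carrier_mat (p - 1) (p - 1 - 1)" "N2 \<in> carrier_mat (p - 1 - 1) (p - 1)"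
    "1\<^sub>m (p - 1) = K2 * N2 + N1 * x * h" "N2 * K2 = 1\<^sub>m (p - 1 - 1)" "N2 * (N1 * x) = 0\<^sub>m (p - 1 - 1) 1"
    using split_off_projection[OF N1x h] by metis
  note [simp] = carrier_matD[OF 2(1)] carrier_matD[OF 2(2)]
  show ?thesis
  proof (rule that[of "p - 1 - 1" "K1 * K2" "N2 * N1" "h * N1" y])
    \<comment> \<open>The second decomposition of the identity is inserted between \<open>K1\<close>
      and \<open>N1\<close>.\<close>
    have "K1 * N1 = K1 * (1\<^sub>m (p - 1) * N1)" by (simp add: mat_one_mult)
    also have "\<dots> = K1 * K2 * (N2 * N1) + K1 * (N1 * x) * (h * N1)"
      unfolding 2(3) by (simp add: mat_ring)
    finally show "1\<^sub>m p = K1 * K2 * (N2 * N1) + x * (h * N1) + y * ctranspose a"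
      using 1(3) by (simp flip: xeq)
    have "ctranspose a * (K1 * K2) = ctranspose a * K1 * K2" by (simp add: mat_mult_assoc)
    thus "ctranspose a * (K1 * K2) = 0\<^sub>m 1 (p - 1 - 1)" by (simp add: 1(5) mat_zero_mult)
    have "N2 * N1 * (K1 * K2) = N2 * (N1 * K1 * K2)" by (simp add: mat_mult_assoc)
    thus "N2 * N1 * (K1 * K2) = 1\<^sub>m (p - 1 - 1)" by (simp add: 1(4) 2(4) mat_one_mult)
    show "N2 * N1 * x = 0\<^sub>m (p - 1 - 1) 1" using 2(5) by (simp add: mat_mult_assoc)
  qed (use 1(7) y in \<open>auto intro!: carrier_matI\<close>)
qed

section \<open>Realizations\<close>

text \<open>\<open>M\<close> is the upper left block \<open>-A\<close> of the system matrix, so that \<open>X = A\<^sup>-\<^sup>1 B\<close>.\<close>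

definition realization ::
    "nat \<Rightarrow> nat \<Rightarrow> ratfun mat \<Rightarrow> ratfun mat \<Rightarrow> ratfun mat \<Rightarrow> ratfun mat \<Rightarrow> ratfun mat \<Rightarrow> bool" where
  "realization p m M B C D H \<longleftrightarrow>
     M \<in> pencil_mats p p \<and> B \<in> pencil_mats p m \<and> C \<in> pencil_mats m p \<and> D \<in> pencil_mats m m \<and>
     det M \<noteq> 0 \<and> (\<exists>X \<in> carrier_mat p m. M * X + B = 0\<^sub>m p m \<and> C * X + D = H)"

section \<open>The companion realization\<close>

text \<open>The index l corresponds to the pair (\<open>l div d\<close>, \<open>l mod d\<close>).
  This splits sums over the state vector into m blocks of length d.\<close>

lemma sum_div_mod:
  fixes g :: "nat \<Rightarrow> nat \<Rightarrow> 'a :: comm_monoid_add"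
  assumes "0 < d"
  shows "(\<Sum>l<m * d. g (l div d) (l mod d)) = (\<Sum>b<m. \<Sum>a<d. g b a)"
proof -
  have "(\<Sum>l<m * d. g (l div d) (l mod d)) =
      (\<Sum>b<m. \<Sum>l\<in>{b * d..<b * d + d}. g (l div d) (l mod d))"
    by (rule sum.nat_group[symmetric])
  also have "\<dots> = (\<Sum>b<m. \<Sum>a<d. g b a)"
  proof (rule sum.cong[OF refl])
    fix b
    have "(\<Sum>l\<in>{0 + b * d..<d + b * d}. g (l div d) (l mod d)) = (\<Sum>a\<in>{0..<d}. g b a)"
      unfolding sum.shift_bounds_nat_ivl by (intro sum.cong) auto
    thus "(\<Sum>l\<in>{b * d..<b * d + d}. g (l div d) (l mod d)) = (\<Sum>a<d. g b a)"
      by (simp add: add.commute atLeast0LessThan)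
  qed
  finally show ?thesis .
qed

text \<open>Coefficients beyond the degree are zero, so numerators and denominator of different
  degrees can share the same powers of z up to d - 1.\<close>

lemma to_fract_poly:
  assumes "degree q < d"
  shows "to_fract q = (\<Sum>a<d. cst (coeff q a) * Z ^ a)"
proof -
  have "q = (\<Sum>a<d. monom (coeff q a) a)"
    using assms by (subst poly_as_sum_of_monoms'[of q "d - 1", symmetric])
      (auto intro!: sum.cong)
  hence "to_fract q = (\<Sum>a<d. to_fract (monom (coeff q a) a))"
    by (metis to_fract_sum)
  moreover have "to_fract (monom c a) = cst c * Z ^ a" for c a
  proof (induction a)
    case (Suc a)
    have "monom c (Suc a) = [:0, 1:] * monom c a" by (simp add: monom_Suc)
    thus ?case using Suc by (simp only: to_fract_mult power_Suc mult_ac)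
  qed (simp add: cst_def monom_0)
  ultimately show ?thesis by simp
qed

text \<open>The product of the denominators of all entries is a common denominator.\<close>

lemma common_denominator:
  fixes H :: "nat \<Rightarrow> nat \<Rightarrow> ratfun"
  obtains q N where "q \<noteq> 0" "\<And>i j. i < m \<Longrightarrow> j < n \<Longrightarrow> H i j = to_fract (N i j) / to_fract q"
proof -
  have "\<exists>a b. b \<noteq> 0 \<and> H i j = to_fract a / to_fract b" for i j
    by (cases "H i j") (auto simp: Fract_conv_to_fract)
  then obtain a b where ab: "b i j \<noteq> 0" "H i j = to_fract (a i j) / to_fract (b i j)" for i j
    by metis
  define I where "I = {..<m} \<times> {..<n}"
  define q where "q = (\<Prod>(i, j)\<in>I. b i j)"
  have "finite I" by (simp add: I_def)
  show ?thesis
  proof (rule that)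
    show "q \<noteq> 0" using ab(1) by (auto simp: q_def I_def prod_zero_iff)
    fix i j assume "i < m" "j < n"
    hence "q = b i j * (\<Prod>(i, j)\<in>I - {(i, j)}. b i j)"
      using prod.remove[OF \<open>finite I\<close>, of "(i, j)" "\<lambda>(i, j). b i j"] by (simp add: q_def I_def)
    thus "H i j = to_fract (a i j * (\<Prod>(i, j)\<in>I - {(i, j)}. b i j)) / to_fract q"
      using ab \<open>q \<noteq> 0\<close> by simp
  qed
qed

text \<open>The companion realization: with \<open>H = N / q\<close>, the state vector consists of the blocks
  \<open>z\<^sup>a / q\<close> for \<open>a < d\<close>, and the component \<open>a\<close> of the block \<open>b\<close> has index \<open>b d + a\<close>.\<close>

lemma realization_exists:
  assumes H: "H \<in> carrier_mat m m"
  obtains p M B C D where "realization p m M B C D H"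
proof -
  obtain q N where q: "q \<noteq> 0"
    and HN: "\<And>i j. i < m \<Longrightarrow> j < m \<Longrightarrow> H $$ (i, j) = to_fract (N i j) / to_fract q"
    using common_denominator[of m m "\<lambda>i j. H $$ (i, j)"] by metis
  \<comment> \<open>With d larger than the degrees of q and of all numerators, the powers z^a with a
    < d suffice to express them all. The \<open>Suc\<close> also makes d positive when m =
    0.\<close>
  define d where "d = Suc (Max (insert (degree q) ((\<lambda>(i, j). degree (N i j)) ` ({..<m} \<times> {..<m}))))"
  have dq: "degree q < d" unfolding d_def less_Suc_eq_le by (intro Max_ge) auto
  have dN: "degree (N i j) < d" if "i < m" "j < m" for i j
    unfolding d_def less_Suc_eq_le using that by (intro Max_ge) force+
  have d: "0 < d" by (simp add: d_def)
  define p where "p = m * d"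
  have div: "i div d < m" "i mod d < d" if "i < p" for i
    using that d by (simp_all add: p_def less_mult_imp_div_less)
  define Q where "Q = to_fract q"
  have Q: "Q \<noteq> 0" "Q = (\<Sum>a<d. cst (coeff q a) * Z ^ a)"
    using q by (simp add: Q_def) (simp only: Q_def to_fract_poly[OF dq])
  \<comment> \<open>Within a block, row a < d - 1 encodes z x_a - x_{a+1} = 0. The last row of the
    block encodes that the sum of the \<open>coeff q a\<close> x_a equals 1 in the column belonging
    to the block and 0 in the others; \<open>B\<close> supplies that right-hand side.\<close>
  define E where "E i l = (if i mod d = d - 1 then (if l div d = i div d then cst (coeff q (l mod d)) else 0)
    else if l = i then Z else if l = Suc i then cst (-1) else 0)" for i l
  define M where "M = mat p p (\<lambda>(i, l). E i l)"
  define B where "B = mat p m (\<lambda>(i, j). if i mod d = d - 1 \<and> i div d = j then cst (-1) else 0)"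
  define C where "C = mat m p (\<lambda>(i, l). cst (coeff (N i (l div d)) (l mod d)))"
  define X where "X = mat p m (\<lambda>(l, j). if l div d = j then Z ^ (l mod d) / Q else 0)"
  have M: "M \<in> carrier_mat p p" and X: "X \<in> carrier_mat p m" and B: "B \<in> carrier_mat p m"
    and C: "C \<in> carrier_mat m p"
    by (simp_all add: M_def X_def B_def C_def)
  have sum_last: "(\<Sum>l<p. E i l * v l) = (\<Sum>a<d. cst (coeff q a) * v (i div d * d + a))"
    if "i < p" "i mod d = d - 1" for i and v :: "nat \<Rightarrow> ratfun"
  proof -
    have "(\<Sum>l<p. E i l * v l) = (\<Sum>l<m * d. (if l div d = i div d then
        cst (coeff q (l mod d)) * v (l div d * d + l mod d) else 0))"
      unfolding p_def using that
      by (intro sum.cong) (auto simp: E_def, metis div_mult_mod_eq)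
    also have "\<dots> = (\<Sum>b<m. \<Sum>a<d. (if b = i div d then cst (coeff q a) * v (b * d + a) else 0))"
      by (rule sum_div_mod[OF d])
    also have "\<dots> = (\<Sum>b<m. if b = i div d then (\<Sum>a<d. cst (coeff q a) * v (b * d + a)) else 0)"
      by (intro sum.cong) auto
    finally show ?thesis using div[OF that(1)] by simp
  qed
  \<comment> \<open>Away from the last row of a block, the successor index stays in the same block,
    so the entry -1 next to the diagonal never links two blocks.\<close>
  have Suc_lt: "Suc i < p" "Suc i div d = i div d" "Suc i mod d = Suc (i mod d)"
    if "i < p" "i mod d \<noteq> d - 1" for i
  proof -
    have *: "Suc (i mod d) < d" using that d mod_less_divisor[OF d, of i] by linarith
    show mod: "Suc i mod d = Suc (i mod d)" using * by (simp add: mod_Suc)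
    show "Suc i div d = i div d" using mod by (simp add: div_Suc)
    hence "Suc i div d < m" using div[OF that(1)] by simp
    thus "Suc i < p" unfolding p_def using d by (simp add: div_less_iff_less_mult)
  qed
  have sum_step: "(\<Sum>l<p. E i l * v l) = Z * v i - v (Suc i)"
    if "i < p" "i mod d \<noteq> d - 1" for i and v :: "nat \<Rightarrow> ratfun"
  proof -
    have "(\<Sum>l<p. E i l * v l) = (\<Sum>l<p. (if l = i then Z * v i else 0) + (if l = Suc i then - v (Suc i) else 0))"
      using that by (intro sum.cong) (auto simp: E_def cst.hom_uminus)
    thus ?thesis using that Suc_lt(1)[OF that] by (simp add: sum.distrib)
  qed
  have "M * X + B = 0\<^sub>m p m"
  proof (rule eq_matI)
    fix i j assume "i < dim_row (0\<^sub>m p m :: ratfun mat)" "j < dim_col (0\<^sub>m p m :: ratfun mat)"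
    hence ij: "i < p" "j < m" by auto
    have MX: "(M * X) $$ (i, j) = (\<Sum>l<p. E i l * X $$ (l, j))"
      using ij M X by (simp add: scalar_prod_def M_def atLeast0LessThan)
    show "(M * X + B) $$ (i, j) = 0\<^sub>m p m $$ (i, j)"
    proof (cases "i mod d = d - 1")
      case True
      have lt: "i div d * d + a < p" if "a < d" for a
        using div(1)[OF ij(1)] that d by (simp add: p_def flip: div_less_iff_less_mult)
      have "(M * X) $$ (i, j) = (\<Sum>a<d. cst (coeff q a) * X $$ (i div d * d + a, j))"
        unfolding MX by (rule sum_last[OF ij(1) True])
      also have "\<dots> = (\<Sum>a<d. if i div d = j then cst (coeff q a) * Z ^ a / Q else 0)"
        using lt ij by (intro sum.cong) (auto simp: X_def)
      also have "\<dots> = (if i div d = j then 1 else 0)"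
        using Q by (simp flip: sum_divide_distrib)
      finally show ?thesis using True ij M X B by (auto simp: B_def cst.hom_uminus)
    next
      case False
      have "(M * X) $$ (i, j) = Z * X $$ (i, j) - X $$ (Suc i, j)"
        unfolding MX by (rule sum_step[OF ij(1) False])
      also have "\<dots> = 0" using ij Suc_lt[OF ij(1) False] by (simp add: X_def)
      finally show ?thesis using False ij M X B by (auto simp: B_def)
    qed
  qed (use M X B in auto)
  moreover have "C * X + 0\<^sub>m m m = H"
  proof (rule eq_matI)
    fix i j assume "i < dim_row H" "j < dim_col H"
    hence ij: "i < m" "j < m" using H by auto
    have "(C * X + 0\<^sub>m m m) $$ (i, j) = (\<Sum>l<p. C $$ (i, l) * X $$ (l, j))"
      using ij C X by (simp add: scalar_prod_def atLeast0LessThan)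
    also have "\<dots> = (\<Sum>l<m * d. (\<lambda>b a. if b = j then cst (coeff (N i b) a) * Z ^ a / Q else 0) (l div d) (l mod d))"
      unfolding p_def[symmetric] using ij by (intro sum.cong) (auto simp: C_def X_def)
    also have "\<dots> = (\<Sum>b<m. \<Sum>a<d. if b = j then cst (coeff (N i b) a) * Z ^ a / Q else 0)"
      by (rule sum_div_mod[OF d])
    also have "\<dots> = (\<Sum>b<m. if b = j then (\<Sum>a<d. cst (coeff (N i b) a) * Z ^ a / Q) else 0)"
      by (intro sum.cong) auto
    also have "\<dots> = to_fract (N i j) / Q"
      using ij by (simp add: to_fract_poly[OF dN[OF ij]] flip: sum_divide_distrib)
    also have "\<dots> = H $$ (i, j)" using HN[OF ij] by (simp add: Q_def)
    finally show "(C * X + 0\<^sub>m m m) $$ (i, j) = H $$ (i, j)" .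
  qed (use H C X in auto)
  moreover have "det M \<noteq> 0"
  proof (rule det_nonzeroI[OF M])
    fix V assume V: "V \<in> carrier_mat p 1" and MV: "M * V = 0\<^sub>m p 1"
    define v where "v l = V $$ (l, 0)" for l
    have Ev: "(\<Sum>l<p. E i l * v l) = 0" if "i < p" for i
      using that M V arg_cong[OF MV, of "\<lambda>A. A $$ (i, 0)"]
      by (simp add: scalar_prod_def M_def atLeast0LessThan v_def)
    \<comment> \<open>The inner rows propagate a null vector through a block by multiplication with
      z, so the first component of the block determines the others.\<close>
    have pow: "v (b * d + a) = Z ^ a * v (b * d)" if "b < m" "a < d" for a b
      using that(2)
    proof (induction a)
      case (Suc a)
      have lt: "b * d + a < p" using that(1) Suc.prems d by (simp add: p_def flip: div_less_iff_less_mult)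
      have "(b * d + a) mod d \<noteq> d - 1" using Suc.prems by simp
      from sum_step[OF lt this, of v] Ev[OF lt] have "v (b * d + Suc a) = Z * v (b * d + a)" by simp
      with Suc show ?case by simp
    qed simp
    \<comment> \<open>The last row of the block then says that q times the first component is
      zero.\<close>
    have v0: "v (b * d) = 0" if "b < m" for b
    proof -
      define i where "i = b * d + (d - 1)"
      have "i mod d = (d - 1) mod d" unfolding i_def by (rule mod_mult_self3)
      moreover have "i div d = b + (d - 1) div d" unfolding i_def using d by (intro div_mult_self3) simp
      ultimately have i: "i mod d = d - 1" "i div d = b" using d by simp_all
      hence lt: "i < p" using that by (simp only: p_def flip: div_less_iff_less_mult[OF d])
      have "0 = (\<Sum>a<d. cst (coeff q a) * v (b * d + a))"
        using sum_last[OF lt i(1), of v] Ev[OF lt] i(2) by simp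
      also have "\<dots> = (\<Sum>a<d. cst (coeff q a) * Z ^ a * v (b * d))"
        using that by (intro sum.cong) (auto simp: pow)
      also have "\<dots> = Q * v (b * d)" unfolding Q(2) by (rule sum_distrib_right[symmetric])
      finally show ?thesis using Q(1) by simp
    qed
    show "V = 0\<^sub>m p 1"
    proof (rule eq_matI)
      fix i j assume "i < dim_row (0\<^sub>m p 1 :: ratfun mat)" "j < dim_col (0\<^sub>m p 1 :: ratfun mat)"
      hence ij: "i < p" "j = 0" by auto
      have "v (i div d * d + i mod d) = 0" unfolding pow[OF div[OF ij(1)]] v0[OF div(1)[OF ij(1)]] by simp
      thus "V $$ (i, j) = 0\<^sub>m p 1 $$ (i, j)" using ij by (simp add: v_def)
    qed (use V in auto)
  qed
  moreover have "M \<in> pencil_mats p p" "B \<in> pencil_mats p m" "C \<in> pencil_mats m p"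
    by (auto simp: pencil_mats_def M_def B_def C_def E_def)
  ultimately have "realization p m M B C (0\<^sub>m m m) H"
    using X by (auto simp: realization_def)
  thus ?thesis by (rule that)
qed

section \<open>Palindromic realizations\<close>

text \<open>The conditions say that \<open>dag\<close> fixes the system matrix;
  \<open>dag B = C\<close> is implied because \<open>dag\<close> is an involution.\<close>

definition palindromic_realization where
  "palindromic_realization p m M B C D H \<longleftrightarrow>
     realization p m M B C D H \<and> dag M = M \<and> dag C = B \<and> dag D = D"

lemma four_block_mult_append_rows:
  fixes A B C D X Y :: "'a :: comm_ring_1 mat"
  assumes "A \<in> carrier_mat r1 s1" "B \<in> carrier_mat r1 s2" "C \<in> carrier_mat r2 s1" "D \<in> carrier_mat r2 s2"
    "X \<in> carrier_mat s1 n" "Y \<in> carrier_mat s2 n"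
  shows "four_block_mat A B C D * (X @\<^sub>r Y) = (A * X + B * Y) @\<^sub>r (C * X + D * Y)"
proof -
  note [simp] = assms[THEN carrier_matD(1)] assms[THEN carrier_matD(2)]
  have "four_block_mat A B C D * (X @\<^sub>r Y) =
      four_block_mat (A * X + B * Y) (A * 0\<^sub>m s1 0 + B * 0\<^sub>m s2 0) (C * X + D * Y) (C * 0\<^sub>m s1 0 + D * 0\<^sub>m s2 0)"
    unfolding append_rows_def carrier_matD(1)[OF assms(5)] carrier_matD(1)[OF assms(6)]
    by (rule mult_four_block_mat[OF assms(1-5) zero_carrier_mat assms(6) zero_carrier_mat])
  also have "\<dots> = (A * X + B * Y) @\<^sub>r (C * X + D * Y)"
    unfolding append_rows_def by (simp add: mat_mult_zero mat_zero_add)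
  finally show ?thesis .
qed

lemma append_cols_mult_append_rows:
  fixes A B X Y :: "'a :: comm_ring_1 mat"
  assumes "A \<in> carrier_mat r s1" "B \<in> carrier_mat r s2" "X \<in> carrier_mat s1 n" "Y \<in> carrier_mat s2 n"
  shows "append_cols A B * (X @\<^sub>r Y) = A * X + B * Y"
proof -
  note [simp] = assms[THEN carrier_matD(1)] assms[THEN carrier_matD(2)]
  have "append_cols A B * (X @\<^sub>r Y) = (A * X + B * Y) @\<^sub>r (0\<^sub>m 0 s1 * X + 0\<^sub>m 0 s2 * Y)"
    unfolding append_cols_def
    using four_block_mult_append_rows[OF assms(1,2) zero_carrier_mat zero_carrier_mat assms(3,4), of 0]
    by simp
  also have "\<dots> = A * X + B * Y"
    by (rule eq_matI) (auto simp: append_rows_def)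
  finally show ?thesis .
qed

lemma append_rows_add:
  assumes "A \<in> carrier_mat r n" "C \<in> carrier_mat r n" "B \<in> carrier_mat s n" "D \<in> carrier_mat s n"
  shows "(A @\<^sub>r B) + (C @\<^sub>r D) = (A + C) @\<^sub>r (B + D)"
  using assms by (intro eq_matI) (auto simp: append_rows_def)

lemma dag_append_cols:
  "dim_row C = dim_row E \<Longrightarrow> dag (append_cols C E) = dag C @\<^sub>r dag E"
  by (intro eq_matI) (auto simp: append_rows_def append_cols_def dag_def adj_def)

lemma append_rows_pencil_mats:
  "F \<in> pencil_mats r n \<Longrightarrow> G \<in> pencil_mats s n \<Longrightarrow> F @\<^sub>r G \<in> pencil_mats (r + s) n"
  by (auto simp: pencil_mats_def append_rows_def)

lemma append_cols_pencil_mats: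
  "F \<in> pencil_mats n r \<Longrightarrow> G \<in> pencil_mats n s \<Longrightarrow> append_cols F G \<in> pencil_mats n (r + s)"
  by (auto simp: pencil_mats_def append_cols_def)

text \<open>Applying \<open>dag\<close> to the system matrix realizes \<open>dag H\<close>, hence H
  itself. Coupling the original system and its mirror image through an antidiagonal state matrix
  makes the pair symmetric, with transfer function (H + \<open>dag H\<close>)/2.\<close>

lemma palindromic_realization_exists:
  assumes real: "realization p m M B C D H" and H: "H \<in> carrier_mat m m" "dag H = H"
  obtains M' B' C' D' where "palindromic_realization (p + p) m M' B' C' D' H"
proof -
  from real have pencils: "M \<in> pencil_mats p p" "B \<in> pencil_mats p m" "C \<in> pencil_mats m p" "D \<in> pencil_mats m m"
    and "det M \<noteq> 0" by (auto simp: realization_def)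
  note carrier = pencils[THEN pencil_mats_carrier]
  from real obtain X where X: "X \<in> carrier_mat p m" "M * X + B = 0\<^sub>m p m" "C * X + D = H"
    by (auto simp: realization_def)
  obtain N where N: "N \<in> carrier_mat p p" "M * N = 1\<^sub>m p" "N * M = 1\<^sub>m p"
    using mat_inverse_exists[OF carrier(1) \<open>det M \<noteq> 0\<close>] .
  define h where "h = cst (1 / 2)"
  have h: "conj_recip h = h" "h + h = 1"
    by (simp_all add: h_def flip: cst.hom_add)
  \<comment> \<open>Y = - C M^-1 is the solution of the row equation Y M + C = 0. It satisfies Y B =
    C X, and its adjoint is the state of the mirrored system.\<close>
  define Y where "Y = cst (-1) \<cdot>\<^sub>m (C * N)"
  have Y: "Y \<in> carrier_mat m p" using carrier N by (simp add: Y_def)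
  note [simp] = carrier[THEN carrier_matD(1)] carrier[THEN carrier_matD(2)] carrier_matD[OF X(1)]
    carrier_matD[OF N(1)] carrier_matD[OF Y] carrier_matD[OF H(1)]
  have neg: "F + cst (-1) \<cdot>\<^sub>m F = 0\<^sub>m (dim_row F) (dim_col F)" for F
    by (intro eq_matI) (auto simp: cst.hom_uminus)
  have YM: "C + Y * M = 0\<^sub>m m p"
    by (simp add: Y_def mat_ring N neg)
  have YB: "Y * B = C * X"
  proof -
    have "C * X + (Y * M * X + Y * B) = Y * B + (C + Y * M) * X"
      by (simp add: mat_ring mat_add_ac)
    moreover have "Y * M * X + Y * B = Y * (M * X + B)" by (simp add: mat_ring)
    ultimately show ?thesis by (simp add: YM X mat_ring)
  qed
  \<comment> \<open>Scaling \<open>B\<close> and \<open>dag B\<close> by 1/2, and leaving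
    \<open>C\<close> and \<open>dag C\<close> as they are, keeps \<open>dag C' = B'\<close> and
    makes each of the two systems contribute half of its transfer function.\<close>
  define M' where "M' = four_block_mat (0\<^sub>m p p) (dag M) M (0\<^sub>m p p)"
  define B' where "B' = dag C @\<^sub>r (h \<cdot>\<^sub>m B)"
  define C' where "C' = append_cols C (h \<cdot>\<^sub>m dag B)"
  define D' where "D' = h \<cdot>\<^sub>m (D + dag D)"
  define X' where "X' = (h \<cdot>\<^sub>m X) @\<^sub>r adj Y"
  have hX: "h \<cdot>\<^sub>m X \<in> carrier_mat p m" and hB: "h \<cdot>\<^sub>m B \<in> carrier_mat p m"
    and hdB: "h \<cdot>\<^sub>m dag B \<in> carrier_mat m p"
    and ZN: "inverse Z \<cdot>\<^sub>m adj N \<in> carrier_mat p p"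
    by (rule carrier_matI; simp)+
  note adjY = adj_carrier[OF Y]
  note dagM = dag_carrier[OF carrier(1)]
  have "dag M' = M'"
    unfolding M'_def
    using dag_four_block[OF zero_carrier_mat dag_carrier[OF carrier(1)] carrier(1) zero_carrier_mat]
    by (simp only: dag_zero dag_dag)
  moreover have "dag C' = B'"
    unfolding B'_def C'_def by (simp add: dag_append_cols dag_smult h)
  moreover have "dag D' = D'"
    unfolding D'_def by (simp add: dag_smult h dag_add[OF carrier(4) dag_carrier[OF carrier(4)]] mat_add_commute)
  moreover have "M' * X' + B' = 0\<^sub>m (p + p) m"
  proof -
    have dM: "dag M * adj Y + dag C = 0\<^sub>m p m"
    proof -
      have "dag (C + Y * M) = dag C + dag (Y * M)"
        by (rule dag_add[OF carrier(3)]) (rule carrier_matI; simp)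
      also have "dag (Y * M) = dag M * adj Y" by (rule dag_mult(2)[OF Y carrier(1)])
      finally show ?thesis by (simp add: YM mat_add_commute)
    qed
    have "M' * X' + B' = (0\<^sub>m p p * (h \<cdot>\<^sub>m X) + dag M * adj Y + dag C) @\<^sub>r
        (M * (h \<cdot>\<^sub>m X) + 0\<^sub>m p p * adj Y + h \<cdot>\<^sub>m B)"
      unfolding M'_def X'_def B'_def
        four_block_mult_append_rows[OF zero_carrier_mat dagM carrier(1) zero_carrier_mat hX adjY]
      by (rule append_rows_add) (rule carrier_matI; simp)+
    also have "\<dots> = 0\<^sub>m p m @\<^sub>r (h \<cdot>\<^sub>m (M * X + B))"
      by (simp add: mat_ring dM)
    also have "\<dots> = 0\<^sub>m (p + p) m" unfolding X by (auto simp: append_rows_def intro!: eq_matI)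
    finally show ?thesis .
  qed
  moreover have "C' * X' + D' = H"
  proof -
    have "dag H = dag (C * X) + dag D"
      unfolding X(3)[symmetric] by (rule dag_add[OF _ carrier(4)]) (rule carrier_matI; simp)
    also have "dag (C * X) = dag B * adj Y"
      unfolding YB[symmetric] by (rule dag_mult(2)[OF Y carrier(2)])
    finally have dB: "dag B * adj Y + dag D = H" using H by simp
    have "C' * X' = C * (h \<cdot>\<^sub>m X) + h \<cdot>\<^sub>m dag B * adj Y"
      unfolding C'_def X'_def by (rule append_cols_mult_append_rows[OF carrier(3) hdB hX adjY])
    hence "C' * X' + D' = h \<cdot>\<^sub>m (C * X + D) + h \<cdot>\<^sub>m (dag B * adj Y + dag D)"
      by (simp add: D'_def mat_ring mat_add_ac)
    also have "\<dots> = H"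
      unfolding X(3) dB using H(1) h(2)
      by (intro eq_matI) (auto simp flip: distrib_right)
    finally show ?thesis .
  qed
  moreover have "det M' \<noteq> 0"
  proof -
    \<comment> \<open>This is the inverse of \<open>M'\<close>: since \<open>dag M\<close> is z
      times \<open>adj M\<close>, its inverse is \<open>adj N\<close> divided by z.\<close>
    define N' where "N' = four_block_mat (0\<^sub>m p p) N (inverse Z \<cdot>\<^sub>m adj N) (0\<^sub>m p p)"
    have "dag M * adj N = dag (N * M)" by (rule dag_mult(2)[OF N(1) carrier(1), symmetric])
    hence "dag M * adj N = Z \<cdot>\<^sub>m 1\<^sub>m p" by (simp add: N dag_def)
    hence dMN: "dag M * (inverse Z \<cdot>\<^sub>m adj N) = 1\<^sub>m p"
      by (simp add: mat_mult_smult mat_smult_smult mat_one_smult)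
    have "M' * N' = four_block_mat (0\<^sub>m p p * 0\<^sub>m p p + dag M * (inverse Z \<cdot>\<^sub>m adj N))
        (0\<^sub>m p p * N + dag M * 0\<^sub>m p p) (M * 0\<^sub>m p p + 0\<^sub>m p p * (inverse Z \<cdot>\<^sub>m adj N)) (M * N + 0\<^sub>m p p * 0\<^sub>m p p)"
      unfolding M'_def N'_def
      by (rule mult_four_block_mat[OF zero_carrier_mat dagM carrier(1) zero_carrier_mat
            zero_carrier_mat N(1) ZN zero_carrier_mat])
    also have "\<dots> = four_block_mat (1\<^sub>m p) (0\<^sub>m p p) (0\<^sub>m p p) (1\<^sub>m p)"
      by (simp add: dMN N mat_ring)
    also have "\<dots> = 1\<^sub>m (p + p)" by (simp add: four_block_one_mat)
    finally have "M' * N' = 1\<^sub>m (p + p)" .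
    moreover have "det M' * det N' = det (M' * N')"
      by (rule det_mult[of _ "p + p", symmetric]) (rule carrier_matI; simp add: M'_def N'_def)+
    ultimately have "det M' * det N' = 1" by simp
    thus ?thesis by auto
  qed
  moreover have "M' \<in> pencil_mats (p + p) (p + p)" "B' \<in> pencil_mats (p + p) m"
    "C' \<in> pencil_mats m (p + p)" "D' \<in> pencil_mats m m"
    unfolding M'_def B'_def C'_def D'_def h_def using pencils
    by (auto intro!: four_block_pencil_mats append_rows_pencil_mats append_cols_pencil_mats
        smult_pencil_mats dag_pencil_mats add_pencil_mats)
  moreover have "X' \<in> carrier_mat (p + p) m"
    unfolding X'_def by (rule carrier_append_rows[OF hX adjY])
  ultimately have "palindromic_realization (p + p) m M' B' C' D' H"
    by (auto simp: palindromic_realization_def realization_def)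
  thus ?thesis by (rule that)
qed

section \<open>Removing states from a palindromic realization\<close>

text \<open>This is the congruence of the system matrix with the block matrix [1 Y; 0 1] on the
  right and its conjugate transpose on the left. Congruence preserves the symmetry, and constant Y
  preserves degree one. The lower right block of the factor is the identity, so the transfer
  function is unchanged.\<close>

lemma palindromic_realization_shift:
  assumes real: "palindromic_realization p m M B C D H" and Y: "Y \<in> carrier_mat p m"
  shows "palindromic_realization p m M (M * cmat Y + B) (cmat (ctranspose Y) * M + C)
    (cmat (ctranspose Y) * (M * cmat Y + B) + (C * cmat Y + D)) H"
proof -
  from real have pencils: "M \<in> pencil_mats p p" "B \<in> pencil_mats p m" "C \<in> pencil_mats m p" "D \<in> pencil_mats m m"
    and det: "det M \<noteq> 0" and dag: "dag M = M" "dag C = B" "dag D = D"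
    by (auto simp: palindromic_realization_def realization_def)
  note carrier = pencils[THEN pencil_mats_carrier]
  from real obtain X where X: "X \<in> carrier_mat p m" "M * X + B = 0\<^sub>m p m" "C * X + D = H"
    by (auto simp: palindromic_realization_def realization_def)
  define U where "U = cmat Y"
  have U: "U \<in> carrier_mat p m" using Y by (simp add: U_def)
  have adjU: "adj U = cmat (ctranspose Y)" by (simp add: U_def)
  have Up: "U \<in> pencil_mats p m" "adj U \<in> pencil_mats m p" using Y by (simp_all add: U_def)
  note [simp] = carrier[THEN carrier_matD(1)] carrier[THEN carrier_matD(2)] carrier_matD[OF X(1)]
    carrier_matD[OF U]
  have MUB: "M * U + B \<in> carrier_mat p m" and CU: "C * U \<in> carrier_mat m m"
    and UM: "adj U * M \<in> carrier_mat m p" and UB: "adj U * (M * U + B) \<in> carrier_mat m m"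
    and MU: "M * U \<in> carrier_mat p m" and CUD: "C * U + D \<in> carrier_mat m m"
    by (rule carrier_matI; simp)+
  have dagB: "dag B = C" using dag(2) dag_dag[of C] by simp
  have 1: "dag (adj U * M + C) = M * U + B"
    by (simp add: dag_add[OF UM carrier(3)] dag_mult(2)[OF adj_carrier[OF U] carrier(1)] dag)
  hence 2: "dag (M * U + B) = adj U * M + C" using dag_dag[of "adj U * M + C"] by simp
  have 3: "dag (adj U * (M * U + B) + (C * U + D)) = adj U * (M * U + B) + (C * U + D)"
    unfolding dag_add[OF UB CUD] dag_add[OF CU carrier(4)] dag_mult(2)[OF adj_carrier[OF U] MUB] 2
      dag_mult(1)[OF carrier(3) U]
    by (simp add: dag mat_ring mat_add_ac)
  \<comment> \<open>The change of coordinates subtracts Y from the state.\<close>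
  define X' where "X' = X + cst (-1) \<cdot>\<^sub>m U"
  have X': "X' \<in> carrier_mat p m" using X U by (simp add: X'_def)
  note [simp] = carrier_matD[OF X']
  have XU: "X' + U = X" using X(1) U by (intro eq_matI) (auto simp: X'_def cst.hom_uminus)
  have 4: "M * X' + (M * U + B) = 0\<^sub>m p m"
  proof -
    have "M * X' + (M * U + B) = M * (X' + U) + B" by (simp add: mat_ring)
    thus ?thesis by (simp add: XU X)
  qed
  have 5: "(adj U * M + C) * X' + (adj U * (M * U + B) + (C * U + D)) = H"
  proof -
    have "(adj U * M + C) * X' + (adj U * (M * U + B) + (C * U + D)) =
        adj U * (M * X' + (M * U + B)) + (C * (X' + U) + D)"
      by (simp add: mat_ring mat_add_ac)
    also have "\<dots> = 0\<^sub>m m m + H" by (simp add: 4 XU X mat_mult_zero)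
    also have "\<dots> = H" using X(3) by (intro mat_zero_add) auto
    finally show ?thesis .
  qed
  have "M * U + B \<in> pencil_mats p m" "adj U * M + C \<in> pencil_mats m p"
    "adj U * (M * U + B) + (C * U + D) \<in> pencil_mats m m"
    unfolding adjU using pencils Y unfolding U_def
    by (auto intro!: add_pencil_mats cmat_mult_pencil_mats[where n = p] pencil_mats_mult_cmat[where n = p])
  hence "palindromic_realization p m M (M * U + B) (adj U * M + C)
    (adj U * (M * U + B) + (C * U + D)) H"
    using pencils det dag 1 3 4 5 X' by (auto simp: palindromic_realization_def realization_def)
  thus ?thesis unfolding adjU unfolding U_def .
qed

lemma cmat_smult: "cmat (k \<cdot>\<^sub>m F) = cst k \<cdot>\<^sub>m cmat F"
  by (intro eq_matI) (auto simp: cst.hom_mult)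

text \<open>The zero (\<alpha> : \<beta>) moves to (\<open>cnj\<close> \<beta> : \<open>cnj\<close>
  \<alpha>), the reflection of the point in the unit circle.\<close>

lemma dag_pencil_root: "conj_recip (Z * cst \<beta> - cst \<alpha>) * Z = cst (cnj \<beta>) - Z * cst (cnj \<alpha>)"
proof -
  have "conj_recip (Z * cst \<beta> - cst \<alpha>) = inverse Z * cst (cnj \<beta>) - cst (cnj \<alpha>)"
    by (simp add: conj_recip.hom_minus conj_recip.hom_mult)
  thus ?thesis by (simp add: left_diff_distrib)
qed

text \<open>Applying \<open>dag\<close> to the two hypotheses on x gives left null relations for M
  and B, which force the state X to be orthogonal to a. Thus X has the form K X' + x W. The part x W
  contributes nothing to the output, since C x = 0, nor to the state equation multiplied by
  \<open>ctranspose K\<close>, since K is orthogonal to a. Only the q < p states in X'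
  remain.\<close>

lemma palindromic_realization_compress:
  assumes real: "palindromic_realization p m M B C D H"
    and x: "x \<in> carrier_mat p 1" "x \<noteq> 0\<^sub>m p 1" and a: "a \<in> carrier_mat p 1" and \<mu>: "\<mu> \<noteq> 0"
    and Mx: "M * cmat x = \<mu> \<cdot>\<^sub>m cmat a" and Cx: "C * cmat x = 0\<^sub>m m 1"
  obtains q M' B' C' D' where "q < p" "palindromic_realization q m M' B' C' D' H"
proof -
  from real have pencils: "M \<in> pencil_mats p p" "B \<in> pencil_mats p m" "C \<in> pencil_mats m p" "D \<in> pencil_mats m m"
    and det: "det M \<noteq> 0" and dag: "dag M = M" "dag C = B" "dag D = D"
    by (auto simp: palindromic_realization_def realization_def)
  note carrier = pencils[THEN pencil_mats_carrier]
  from real obtain X where X: "X \<in> carrier_mat p m" "M * X + B = 0\<^sub>m p m" "C * X + D = H"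
    by (auto simp: palindromic_realization_def realization_def)
  obtain Mi where Mi: "Mi \<in> carrier_mat p p" "Mi * M = 1\<^sub>m p"
    using mat_inverse_exists[OF carrier(1) det] by metis
  note [simp] = carrier[THEN carrier_matD(1)] carrier[THEN carrier_matD(2)] carrier_matD[OF X(1)]
    carrier_matD[OF x(1)] carrier_matD[OF a] carrier_matD[OF Mi(1)]
  have ker: "V = 0\<^sub>m p n" if "V \<in> carrier_mat p n" "M * V = 0\<^sub>m p n" for V n
  proof -
    have "V = Mi * M * V" using that(1) by (simp add: Mi)
    also have "\<dots> = Mi * (M * V)" using that(1) by (simp add: mat_mult_assoc)
    finally show ?thesis using that by (simp add: mat_mult_zero)
  qed
  have "a \<noteq> 0\<^sub>m p 1"
  proof
    assume "a = 0\<^sub>m p 1"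
    hence "M * cmat x = 0\<^sub>m p 1" by (simp add: Mx)
    hence "cmat x = cmat (0\<^sub>m p 1)" using x(1) by (simp add: ker)
    hence "x = 0\<^sub>m p 1" by (rule cmat_inj)
    with x show False by simp
  qed
  from split_off_pair[OF x a this] obtain q K N h y where q: "q < p" and
    KNhy: "K \<in> carrier_mat p q" "N \<in> carrier_mat q p" "h \<in> carrier_mat 1 p" "y \<in> carrier_mat p 1" and
    split: "1\<^sub>m p = K * N + x * h + y * ctranspose a"
    "ctranspose a * K = 0\<^sub>m 1 q" "N * K = 1\<^sub>m q" "N * x = 0\<^sub>m q 1" .
  note [simp] = KNhy[THEN carrier_matD(1)] KNhy[THEN carrier_matD(2)]
  have caK: "cmat (ctranspose a) * cmat K = 0\<^sub>m 1 q"
    using arg_cong[OF split(2), of cmat] by (simp add: cmat_mult)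
  have cKa: "cmat (ctranspose K) * cmat a = 0\<^sub>m q 1"
    using arg_cong[OF caK, of adj] by (simp add: adj_mult')
  have cNK: "cmat N * cmat K = 1\<^sub>m q"
    using arg_cong[OF split(3), of cmat] by (simp add: cmat_mult)
  have cNx: "cmat N * cmat x = 0\<^sub>m q 1"
    using arg_cong[OF split(4), of cmat] by (simp add: cmat_mult)
  have one: "1\<^sub>m p = cmat K * cmat N + cmat x * cmat h + cmat y * cmat (ctranspose a)"
    using arg_cong[OF split(1), of cmat] by (simp add: cmat_mult cmat_add)
  \<comment> \<open>The adjoint decomposition of the identity splits the values of M, just as
    \<open>one\<close> splits its arguments.\<close>
  have one': "1\<^sub>m p = cmat (ctranspose N) * cmat (ctranspose K) + cmat (ctranspose h) * cmat (ctranspose x)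
      + cmat a * cmat (ctranspose y)"
  proof -
    have "adj (1\<^sub>m p) = adj (cmat K * cmat N) + adj (cmat x * cmat h) + adj (cmat y * cmat (ctranspose a))"
      unfolding one using KNhy x a by (subst adj_add[of _ p p]; (subst adj_add[of _ p p])?) (auto intro!: carrier_matI)
    thus ?thesis by (simp add: adj_mult')
  qed
  define \<nu> where "\<nu> = conj_recip \<mu> * Z"
  have \<nu>: "\<nu> \<noteq> 0" using \<mu> by (simp add: \<nu>_def)
  have cx: "cmat x \<in> carrier_mat p 1" using x by simp
  have xM: "cmat (ctranspose x) * M = \<nu> \<cdot>\<^sub>m cmat (ctranspose a)"
    using arg_cong[OF Mx, of dag] unfolding dag_mult(1)[OF carrier(1) cx]
    by (simp add: dag dag_smult) (simp add: dag_def mat_smult_smult \<nu>_def)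
  have xB: "cmat (ctranspose x) * B = 0\<^sub>m 1 m"
    using arg_cong[OF Cx, of dag] unfolding dag_mult(1)[OF carrier(3) cx] by (simp add: dag)
  \<comment> \<open>Multiplying M X + B = 0 on the left by \<open>ctranspose x\<close> leaves only
    the nonzero scalar \<nu> times the product of \<open>ctranspose a\<close> and X.\<close>
  have aX: "cmat (ctranspose a) * X = 0\<^sub>m 1 m"
  proof -
    have "\<nu> \<cdot>\<^sub>m (cmat (ctranspose a) * X) = cmat (ctranspose x) * M * X + cmat (ctranspose x) * B"
      unfolding xM xB by (simp add: mat_ring)
    also have "\<dots> = cmat (ctranspose x) * (M * X + B)" by (simp add: mat_ring)
    also have "\<dots> = \<nu> \<cdot>\<^sub>m 0\<^sub>m 1 m" by (simp add: X mat_mult_zero)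
    finally show ?thesis by (rule mat_smult_cancel[OF \<nu>])
  qed
  define X' where "X' = cmat N * X"
  define W where "W = cmat h * X"
  have X': "X' \<in> carrier_mat q m" and W: "W \<in> carrier_mat 1 m"
    by (rule carrier_matI; simp add: X'_def W_def)+
  note [simp] = carrier_matD[OF X'] carrier_matD[OF W]
  have XKW: "X = cmat K * X' + cmat x * W"
  proof -
    have "X = (cmat K * cmat N + cmat x * cmat h + cmat y * cmat (ctranspose a)) * X"
      using X(1) by (simp flip: one)
    also have "\<dots> = cmat K * X' + cmat x * W"
      unfolding X'_def W_def by (simp add: mat_ring aX)
    finally show ?thesis .
  qed
  define M' where "M' = cmat (ctranspose K) * (M * cmat K)"
  define B' where "B' = cmat (ctranspose K) * B"
  define C' where "C' = C * cmat K"
  have M': "M' \<in> carrier_mat q q" by (rule carrier_matI; simp add: M'_def)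
  have "M' * X' + B' = 0\<^sub>m q m"
  proof -
    have "cmat (ctranspose K) * (M * X) = cmat (ctranspose K) * (M * (cmat K * X'))
        + cmat (ctranspose K) * (M * cmat x) * W"
      by (subst XKW) (simp add: mat_ring)
    also have "cmat (ctranspose K) * (M * cmat x) * W = 0\<^sub>m q m"
      unfolding Mx by (simp add: mat_mult_smult cKa mat_zero_mult)
    finally have "M' * X' + B' = cmat (ctranspose K) * (M * X + B)"
      by (simp add: M'_def B'_def mat_ring)
    thus ?thesis by (simp add: X mat_mult_zero)
  qed
  moreover have "C' * X' + D = H"
  proof -
    have "C * X = C * (cmat K * X') + C * cmat x * W"
      by (subst XKW) (simp add: mat_ring)
    hence "C * X = C' * X'" by (simp add: C'_def Cx mat_ring)
    with X(3) show ?thesis by simp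
  qed
  moreover have "dag M' = M'"
  proof -
    have MK: "M * cmat K \<in> carrier_mat p q" by (rule carrier_matI; simp)
    have "cmat (ctranspose K) \<in> carrier_mat q p" using KNhy by simp
    from dag_mult(2)[OF this MK] have "dag M' = dag (M * cmat K) * cmat K" by (simp add: M'_def)
    also have "dag (M * cmat K) = cmat (ctranspose K) * M"
      using dag_mult(1)[OF carrier(1), of "cmat K" q] KNhy by (simp add: dag)
    finally show ?thesis by (simp add: M'_def mat_mult_assoc)
  qed
  moreover have "dag C' = B'"
    using dag_mult(1)[OF carrier(3), of "cmat K" q] KNhy by (simp add: dag B'_def C'_def)
  moreover have "det M' \<noteq> 0"
  proof (rule det_nonzeroI[OF M'])
    fix V assume V: "V \<in> carrier_mat q 1" and M'V: "M' * V = 0\<^sub>m q 1"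
    note [simp] = carrier_matD[OF V]
    \<comment> \<open>Regularity of the compressed matrix: g is the image of a null vector V under
      M, before multiplication by \<open>ctranspose K\<close>. It is annihilated by
      \<open>ctranspose K\<close> and by \<open>ctranspose x\<close>, so only its component along a
      can survive.\<close>
    define g where "g = M * (cmat K * V)"
    have g: "g \<in> carrier_mat p 1" by (rule carrier_matI; simp add: g_def)
    note [simp] = carrier_matD[OF g]
    have Kg: "cmat (ctranspose K) * g = 0\<^sub>m q 1"
      using M'V by (simp add: M'_def g_def mat_mult_assoc)
    have "cmat (ctranspose x) * g = cmat (ctranspose x) * M * cmat K * V"
      by (simp add: g_def mat_mult_assoc)
    also have "\<dots> = \<nu> \<cdot>\<^sub>m (cmat (ctranspose a) * cmat K * V)"
      unfolding xM by (simp add: mat_smult_mult)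
    finally have xg: "cmat (ctranspose x) * g = 0\<^sub>m 1 1" by (simp add: caK mat_zero_mult)
    define t where "t = cmat (ctranspose y) * g"
    have t: "dim_row t = 1" "dim_col t = 1" by (simp_all add: t_def)
    note [simp] = t
    have gt: "g = cmat a * t"
    proof -
      have "g = (cmat (ctranspose N) * cmat (ctranspose K) + cmat (ctranspose h) * cmat (ctranspose x)
          + cmat a * cmat (ctranspose y)) * g" using g by (simp flip: one')
      also have "\<dots> = cmat a * t" by (simp add: mat_ring Kg xg t_def)
      finally show ?thesis .
    qed
    \<comment> \<open>Since M x = \<mu> a, the vector x t cancels the remaining component of \<mu>
      g. Thus V' lies in the kernel of the regular matrix M, and N recovers \<mu> V from it because
      N x = 0.\<close>
    define V' where "V' = \<mu> \<cdot>\<^sub>m (cmat K * V) + cst (-1) \<cdot>\<^sub>m (cmat x * t)"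
    have V': "V' \<in> carrier_mat p 1" by (rule carrier_matI; simp add: V'_def)
    have "M * V' = \<mu> \<cdot>\<^sub>m g + cst (-1) \<cdot>\<^sub>m (M * cmat x * t)"
      by (simp add: V'_def g_def mat_ring)
    also have "\<dots> = \<mu> \<cdot>\<^sub>m g + cst (-1) \<cdot>\<^sub>m (\<mu> \<cdot>\<^sub>m g)"
      unfolding Mx by (simp add: gt mat_smult_mult)
    also have "\<dots> = 0\<^sub>m p 1" using g by (intro eq_matI) (auto simp: cst.hom_uminus)
    finally have "V' = 0\<^sub>m p 1" by (rule ker[OF V'])
    hence "cmat N * V' = 0\<^sub>m q 1" by (simp add: mat_mult_zero)
    moreover have "cmat N * V' = \<mu> \<cdot>\<^sub>m (cmat N * cmat K * V) + cst (-1) \<cdot>\<^sub>m (cmat N * cmat x * t)"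
      by (simp add: V'_def mat_ring)
    ultimately have "\<mu> \<cdot>\<^sub>m V = \<mu> \<cdot>\<^sub>m 0\<^sub>m q 1"
      by (simp add: cNK cNx mat_ring)
    thus "V = 0\<^sub>m q 1" by (rule mat_smult_cancel[OF \<mu>])
  qed
  moreover have "M' \<in> pencil_mats q q" "B' \<in> pencil_mats q m" "C' \<in> pencil_mats m q"
    unfolding M'_def B'_def C'_def using pencils KNhy
    by (auto intro!: cmat_mult_pencil_mats[where n = p] pencil_mats_mult_cmat[where n = p])
  ultimately have "palindromic_realization q m M' B' C' D H"
    using pencils X' dag by (auto simp: palindromic_realization_def realization_def)
  with q show ?thesis by (rule that)
qed

text \<open>The output part c of the defect is removed by a shift that leaves M alone; then the
  compression with C x = 0 applies.\<close>

lemma palindromic_realization_reduce: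
  assumes real: "palindromic_realization p m M B C D H"
    and x: "x \<in> carrier_mat p 1" "x \<noteq> 0\<^sub>m p 1" and a: "a \<in> carrier_mat p 1" and c: "c \<in> carrier_mat m 1"
    and \<mu>: "\<mu> \<noteq> 0" and Mx: "M * cmat x = \<mu> \<cdot>\<^sub>m cmat a" and Cx: "C * cmat x = \<mu> \<cdot>\<^sub>m cmat c"
  obtains q M' B' C' D' where "q < p" "palindromic_realization q m M' B' C' D' H"
proof -
  from real have pencils: "M \<in> pencil_mats p p" "B \<in> pencil_mats p m" "C \<in> pencil_mats m p" "D \<in> pencil_mats m m"
    and det: "det M \<noteq> 0"
    by (auto simp: palindromic_realization_def realization_def)
  note carrier = pencils[THEN pencil_mats_carrier]
  obtain Mi where Mi: "Mi \<in> carrier_mat p p" "Mi * M = 1\<^sub>m p"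
    using mat_inverse_exists[OF carrier(1) det] by metis
  note [simp] = carrier[THEN carrier_matD(1)] carrier[THEN carrier_matD(2)]
    carrier_matD[OF x(1)] carrier_matD[OF a] carrier_matD[OF c] carrier_matD[OF Mi(1)]
  have "a \<noteq> 0\<^sub>m p 1"
  proof
    assume "a = 0\<^sub>m p 1"
    hence "Mi * (M * cmat x) = 0\<^sub>m p 1" by (simp add: Mx mat_mult_zero)
    hence "cmat x = cmat (0\<^sub>m p 1)" by (simp add: Mi mat_one_mult flip: mat_mult_assoc)
    hence "x = 0\<^sub>m p 1" by (rule cmat_inj)
    with x show False by simp
  qed
  then obtain b where b: "b \<in> carrier_mat 1 p" "b * a = 1\<^sub>m 1"
    using left_inverse_of_nonzero_column[OF a] by metis
  note [simp] = carrier_matD[OF b(1)]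
  \<comment> \<open>Chosen so that \<open>ctranspose Y\<close> sends a to - c, using b a = 1. The
    shifted output matrix then sends x to \<mu> (c - c) = 0.\<close>
  define Y where "Y = ctranspose ((-1) \<cdot>\<^sub>m (c * b))"
  have Y: "Y \<in> carrier_mat p m" using b c by (simp add: Y_def)
  have "ctranspose Y * a = (-1) \<cdot>\<^sub>m c" using b c by (simp add: Y_def mat_ring)
  moreover have "cmat (ctranspose Y) * cmat a = cmat (ctranspose Y * a)"
    by (rule cmat_mult[symmetric]) (use Y in auto)
  ultimately have "cmat (ctranspose Y) * cmat a = cst (-1) \<cdot>\<^sub>m cmat c"
    by (simp only: cmat_smult)
  moreover have "(cmat (ctranspose Y) * M + C) * cmat x = cmat (ctranspose Y) * (M * cmat x) + C * cmat x"
    using Y by (simp add: mat_ring)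
  ultimately have "(cmat (ctranspose Y) * M + C) * cmat x = \<mu> \<cdot>\<^sub>m (cst (-1) \<cdot>\<^sub>m cmat c) + \<mu> \<cdot>\<^sub>m cmat c"
    using Y by (simp add: Mx Cx mat_mult_smult)
  also have "\<dots> = 0\<^sub>m m 1" by (intro eq_matI) (auto simp: cst.hom_uminus)
  finally show ?thesis
    by (rule palindromic_realization_compress[OF palindromic_realization_shift[OF real Y] x a \<mu> Mx _ that])
qed

section \<open>Strong minimality\<close>

interpretation to_fract: inj_comm_ring_hom "to_fract :: complex poly \<Rightarrow> ratfun"
  by unfold_locales auto

definition poly_pencil :: "complex mat \<Rightarrow> complex mat \<Rightarrow> complex poly mat" where
  "poly_pencil F1 F0 = [:0, 1:] \<cdot>\<^sub>m map_mat (\<lambda>c. [:c:]) F1 + map_mat (\<lambda>c. [:c:]) F0"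

lemma poly_pencil:
  assumes "F1 \<in> carrier_mat r s" "F0 \<in> carrier_mat r s"
  shows "poly_pencil F1 F0 \<in> carrier_mat r s" "is_pencil (poly_pencil F1 F0)"
    "rat_mat (poly_pencil F1 F0) = Z \<cdot>\<^sub>m cmat F1 + cmat F0"
    "eval_mat (poly_pencil F1 F0) z = z \<cdot>\<^sub>m F1 + F0" "lead_mat (poly_pencil F1 F0) = F1"
proof -
  show "poly_pencil F1 F0 \<in> carrier_mat r s"
    using assms by (simp add: poly_pencil_def)
  thus "is_pencil (poly_pencil F1 F0)"
    using assms unfolding is_pencil_def
    by - (rule exI[of _ F1], rule exI[of _ F0], auto simp: poly_pencil_def)
  have entry: "to_fract ([:0, 1:] * [:a:] + [:b:]) = Z * cst a + cst b" for a b
    by (simp only: to_fract_add to_fract_mult cst_def)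
  show "rat_mat (poly_pencil F1 F0) = Z \<cdot>\<^sub>m cmat F1 + cmat F0"
    using assms by (intro eq_matI) (simp_all add: rat_mat_def poly_pencil_def flip: entry)
  show "eval_mat (poly_pencil F1 F0) z = z \<cdot>\<^sub>m F1 + F0"
    using assms by (intro eq_matI) (simp_all add: eval_mat_def poly_pencil_def)
  show "lead_mat (poly_pencil F1 F0) = F1"
    using assms by (intro eq_matI) (simp_all add: lead_mat_def poly_pencil_def)
qed

text \<open>At a finite point z, F0 x = - z F1 x, so the linear form \<open>Z - cst z\<close>
  factors out. At infinity F1 x = 0 and the constant F0 x remains; it is written with the form for
  (-1 : 0), which equals 1, so that both cases have the same shape.\<close>

lemma pencil_mult_root:
  assumes F: "F1 \<in> carrier_mat r s" "F0 \<in> carrier_mat r s" "x \<in> carrier_mat s n"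
  shows "(z \<cdot>\<^sub>m F1 + F0) * x = 0\<^sub>m r n \<Longrightarrow>
      (Z \<cdot>\<^sub>m cmat F1 + cmat F0) * cmat x = (Z * cst 1 - cst z) \<cdot>\<^sub>m cmat (F1 * x)"
    and "F1 * x = 0\<^sub>m r n \<Longrightarrow>
      (Z \<cdot>\<^sub>m cmat F1 + cmat F0) * cmat x = (Z * cst 0 - cst (-1)) \<cdot>\<^sub>m cmat (F0 * x)"
proof -
  note [simp] = F[THEN carrier_matD(1)] F[THEN carrier_matD(2)]
  have prod: "(Z \<cdot>\<^sub>m cmat F1 + cmat F0) * cmat x = Z \<cdot>\<^sub>m cmat (F1 * x) + cmat (F0 * x)"
    by (simp add: mat_ring cmat_mult)
  show "(Z \<cdot>\<^sub>m cmat F1 + cmat F0) * cmat x = (Z * cst 0 - cst (-1)) \<cdot>\<^sub>m cmat (F0 * x)"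
    if "F1 * x = 0\<^sub>m r n"
    unfolding prod that by (intro eq_matI) (auto simp: cst.hom_uminus)
  show "(Z \<cdot>\<^sub>m cmat F1 + cmat F0) * cmat x = (Z * cst 1 - cst z) \<cdot>\<^sub>m cmat (F1 * x)"
    if 0: "(z \<cdot>\<^sub>m F1 + F0) * x = 0\<^sub>m r n"
  proof -
    define U V where "U = F1 * x" and "V = F0 * x"
    have [simp]: "dim_row U = r" "dim_col U = n" "dim_row V = r" "dim_col V = n"
      by (simp_all add: U_def V_def)
    have zU: "z \<cdot>\<^sub>m U + V = 0\<^sub>m r n" using 0 by (simp add: mat_ring U_def V_def)
    have V: "V $$ (i, j) = - (z * U $$ (i, j))" if "i < r" "j < n" for i j
      using that arg_cong[OF zU, of "\<lambda>A. A $$ (i, j)"] by (simp add: add_eq_0_iff)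
    show ?thesis unfolding prod U_def[symmetric] V_def[symmetric]
      by (intro eq_matI) (auto simp: V cst.hom_uminus cst.hom_mult left_diff_distrib)
  qed
qed

lemma mult_pencil_root:
  assumes F: "F1 \<in> carrier_mat r s" "F0 \<in> carrier_mat r s" "x \<in> carrier_mat n r"
  shows "x * (z \<cdot>\<^sub>m F1 + F0) = 0\<^sub>m n s \<Longrightarrow>
      cmat x * (Z \<cdot>\<^sub>m cmat F1 + cmat F0) = (Z * cst 1 - cst z) \<cdot>\<^sub>m cmat (x * F1)"
    and "x * F1 = 0\<^sub>m n s \<Longrightarrow>
      cmat x * (Z \<cdot>\<^sub>m cmat F1 + cmat F0) = (Z * cst 0 - cst (-1)) \<cdot>\<^sub>m cmat (x * F0)"
proof -
  note [simp] = F[THEN carrier_matD(1)] F[THEN carrier_matD(2)]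
  have prod: "cmat x * (Z \<cdot>\<^sub>m cmat F1 + cmat F0) = Z \<cdot>\<^sub>m cmat (x * F1) + cmat (x * F0)"
    by (simp add: mat_ring cmat_mult)
  show "cmat x * (Z \<cdot>\<^sub>m cmat F1 + cmat F0) = (Z * cst 0 - cst (-1)) \<cdot>\<^sub>m cmat (x * F0)"
    if "x * F1 = 0\<^sub>m n s"
    unfolding prod that by (intro eq_matI) (auto simp: cst.hom_uminus)
  show "cmat x * (Z \<cdot>\<^sub>m cmat F1 + cmat F0) = (Z * cst 1 - cst z) \<cdot>\<^sub>m cmat (x * F1)"
    if 0: "x * (z \<cdot>\<^sub>m F1 + F0) = 0\<^sub>m n s"
  proof -
    define U V where "U = x * F1" and "V = x * F0"
    have [simp]: "dim_row U = n" "dim_col U = s" "dim_row V = n" "dim_col V = s"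
      by (simp_all add: U_def V_def)
    have zU: "z \<cdot>\<^sub>m U + V = 0\<^sub>m n s" using 0 by (simp add: mat_ring U_def V_def)
    have V: "V $$ (i, j) = - (z * U $$ (i, j))" if "i < n" "j < s" for i j
      using that arg_cong[OF zU, of "\<lambda>A. A $$ (i, j)"] by (simp add: add_eq_0_iff)
    show ?thesis unfolding prod U_def[symmetric] V_def[symmetric]
      by (intro eq_matI) (auto simp: V cst.hom_uminus cst.hom_mult left_diff_distrib)
  qed
qed

lemma append_cols_carrier:
  "A \<in> carrier_mat r s1 \<Longrightarrow> B \<in> carrier_mat r s2 \<Longrightarrow> append_cols A B \<in> carrier_mat r (s1 + s2)"
  by (rule carrier_matI) (auto simp: append_cols_def)

lemma append_rows_mult_eq_0:
  fixes A B x :: "'a :: comm_ring_1 mat"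
  assumes "A \<in> carrier_mat r1 s" "B \<in> carrier_mat r2 s" "x \<in> carrier_mat s n"
    and 0: "(A @\<^sub>r B) * x = 0\<^sub>m (r1 + r2) n"
  shows "A * x = 0\<^sub>m r1 n" "B * x = 0\<^sub>m r2 n"
proof -
  have A: "((A @\<^sub>r B) * x) $$ (i, j) = (A * x) $$ (i, j)" if "i < r1" "j < n" for i j
    using assms(1-3) that by (auto simp: append_rows_def scalar_prod_def)
  have B: "((A @\<^sub>r B) * x) $$ (r1 + i, j) = (B * x) $$ (i, j)" if "i < r2" "j < n" for i j
    using assms(1-3) that by (auto simp: append_rows_def scalar_prod_def)
  show "A * x = 0\<^sub>m r1 n"
  proof (rule eq_matI)
    fix i j assume "i < dim_row (0\<^sub>m r1 n :: 'a mat)" "j < dim_col (0\<^sub>m r1 n :: 'a mat)"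
    thus "(A * x) $$ (i, j) = 0\<^sub>m r1 n $$ (i, j)" using A[of i j] unfolding 0 by simp
  qed (use assms in auto)
  show "B * x = 0\<^sub>m r2 n"
  proof (rule eq_matI)
    fix i j assume "i < dim_row (0\<^sub>m r2 n :: 'a mat)" "j < dim_col (0\<^sub>m r2 n :: 'a mat)"
    thus "(B * x) $$ (i, j) = 0\<^sub>m r2 n $$ (i, j)" using B[of i j] unfolding 0 by simp
  qed (use assms in auto)
qed

lemma mult_append_cols_eq_0:
  fixes A B x :: "'a :: comm_ring_1 mat"
  assumes "A \<in> carrier_mat r s1" "B \<in> carrier_mat r s2" "x \<in> carrier_mat n r"
    and 0: "x * append_cols A B = 0\<^sub>m n (s1 + s2)"
  shows "x * A = 0\<^sub>m n s1" "x * B = 0\<^sub>m n s2"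
proof -
  have A: "(x * append_cols A B) $$ (i, j) = (x * A) $$ (i, j)" if "i < n" "j < s1" for i j
    using assms(1-3) that by (auto simp: append_cols_def scalar_prod_def)
  have B: "(x * append_cols A B) $$ (i, s1 + j) = (x * B) $$ (i, j)" if "i < n" "j < s2" for i j
    using assms(1-3) that by (auto simp: append_cols_def scalar_prod_def)
  show "x * A = 0\<^sub>m n s1"
  proof (rule eq_matI)
    fix i j assume "i < dim_row (0\<^sub>m n s1 :: 'a mat)" "j < dim_col (0\<^sub>m n s1 :: 'a mat)"
    thus "(x * A) $$ (i, j) = 0\<^sub>m n s1 $$ (i, j)" using A[of i j] unfolding 0 by simp
  qed (use assms in auto)
  show "x * B = 0\<^sub>m n s2"
  proof (rule eq_matI)
    fix i j assume "i < dim_row (0\<^sub>m n s2 :: 'a mat)" "j < dim_col (0\<^sub>m n s2 :: 'a mat)"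
    thus "(x * B) $$ (i, j) = 0\<^sub>m n s2 $$ (i, j)" using B[of i j] unfolding 0 by simp
  qed (use assms in auto)
qed

text \<open>Strong minimality over \<open>\<complex>(z)\<close>: the point \<open>(\<alpha> : \<beta>)\<close> of the projective line
  is a zero of \<open>[M; C]\<close> with null vector \<open>x\<close> iff \<open>[M; C] x\<close> is \<open>z \<beta> - \<alpha>\<close> times a constant vector.\<close>

definition defect_free :: "nat \<Rightarrow> nat \<Rightarrow> ratfun mat \<Rightarrow> ratfun mat \<Rightarrow> ratfun mat \<Rightarrow> bool" where
  "defect_free p m M B C \<longleftrightarrow>
    (\<forall>\<alpha> \<beta> x a c. (\<alpha>, \<beta>) \<noteq> (0, 0) \<longrightarrow> x \<in> carrier_mat p 1 \<longrightarrow> a \<in> carrier_mat p 1 \<longrightarrow> c \<in> carrier_mat m 1 \<longrightarrow>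
      M * cmat x = (Z * cst \<beta> - cst \<alpha>) \<cdot>\<^sub>m cmat a \<longrightarrow> C * cmat x = (Z * cst \<beta> - cst \<alpha>) \<cdot>\<^sub>m cmat c \<longrightarrow>
      x = 0\<^sub>m p 1) \<and>
    (\<forall>\<alpha> \<beta> x a c. (\<alpha>, \<beta>) \<noteq> (0, 0) \<longrightarrow> x \<in> carrier_mat 1 p \<longrightarrow> a \<in> carrier_mat 1 p \<longrightarrow> c \<in> carrier_mat 1 m \<longrightarrow>
      cmat x * M = (Z * cst \<beta> - cst \<alpha>) \<cdot>\<^sub>m cmat a \<longrightarrow> cmat x * B = (Z * cst \<beta> - cst \<alpha>) \<cdot>\<^sub>m cmat c \<longrightarrow>
      x = 0\<^sub>m 1 p)"

lemma defect_freeD: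
  assumes "defect_free p m M B C" "(\<alpha>, \<beta>) \<noteq> (0, 0)"
  shows "x \<in> carrier_mat p 1 \<Longrightarrow> a \<in> carrier_mat p 1 \<Longrightarrow> c \<in> carrier_mat m 1 \<Longrightarrow>
      M * cmat x = (Z * cst \<beta> - cst \<alpha>) \<cdot>\<^sub>m cmat a \<Longrightarrow> C * cmat x = (Z * cst \<beta> - cst \<alpha>) \<cdot>\<^sub>m cmat c \<Longrightarrow>
      x = 0\<^sub>m p 1"
    and "y \<in> carrier_mat 1 p \<Longrightarrow> b \<in> carrier_mat 1 p \<Longrightarrow> d \<in> carrier_mat 1 m \<Longrightarrow>
      cmat y * M = (Z * cst \<beta> - cst \<alpha>) \<cdot>\<^sub>m cmat b \<Longrightarrow> cmat y * B = (Z * cst \<beta> - cst \<alpha>) \<cdot>\<^sub>m cmat d \<Longrightarrow>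
      y = 0\<^sub>m 1 p"
  using assms unfolding defect_free_def by metis+

lemma rat_mat_carrier [simp]: "L \<in> carrier_mat r s \<Longrightarrow> rat_mat L \<in> carrier_mat r s"
  by (simp add: rat_mat_def)

lemma dim_rat_mat [simp]: "dim_row (rat_mat L) = dim_row L" "dim_col (rat_mat L) = dim_col L"
  by (simp_all add: rat_mat_def)

lemma rat_mat_uminus: "rat_mat (- L) = - rat_mat L"
  by (intro eq_matI) (auto simp: rat_mat_def)

lemma rat_mat_four_block:
  assumes "A \<in> carrier_mat p q" "B \<in> carrier_mat p n" "C \<in> carrier_mat m q" "D \<in> carrier_mat m n"
  shows "rat_mat (four_block_mat A B C D) = four_block_mat (rat_mat A) (rat_mat B) (rat_mat C) (rat_mat D)"
  unfolding rat_mat_def by (rule map_four_block_mat[OF assms])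

text \<open>Regularity of A guarantees that the computed inverse in \<open>transfer_function\<close>
  exists. The transfer function can then be handled through the unique solution X of A X = B,
  without an explicit inverse.\<close>

lemma transfer_function_states:
  assumes A: "A \<in> carrier_mat p p" and B: "B \<in> carrier_mat p n" and C: "C \<in> carrier_mat m p"
    and D: "D \<in> carrier_mat m n" and det: "det A \<noteq> 0"
  obtains X where "X \<in> carrier_mat p n" "rat_mat A * X = rat_mat B"
    "transfer_function A B C D = rat_mat C * X + rat_mat D"
    "\<And>X'. X' \<in> carrier_mat p n \<Longrightarrow> rat_mat A * X' = rat_mat B \<Longrightarrow> X' = X"
proof -
  have rA: "rat_mat A \<in> carrier_mat p p" using A by simp
  have "det (rat_mat A) = to_fract (det A)"
    by (simp add: rat_mat_def)
  with det have "det (rat_mat A) \<noteq> 0" by simp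
  from det_non_zero_imp_unit[OF rA this, where b = "()"] mat_inverse(1)[OF rA, where b = "()"]
  obtain N where "mat_inverse (rat_mat A) = Some N" by (cases "mat_inverse (rat_mat A)") auto
  note N = this mat_inverse(2)[OF rA this]
  note [simp] = carrier_matD[OF A] carrier_matD[OF B] carrier_matD[OF C] carrier_matD[OF D]
  have [simp]: "dim_row N = p" "dim_col N = p" using N(2) by auto
  show ?thesis
  proof (rule that[of "N * rat_mat B"])
    have "rat_mat A * (N * rat_mat B) = rat_mat A * N * rat_mat B" by (simp add: mat_mult_assoc)
    thus "rat_mat A * (N * rat_mat B) = rat_mat B" using N(2) by (simp add: mat_one_mult)
    show "transfer_function A B C D = rat_mat C * (N * rat_mat B) + rat_mat D"
      by (simp add: transfer_function_def N(1) mat_mult_assoc mat_add_commute)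
    fix X' assume X': "X' \<in> carrier_mat p n" "rat_mat A * X' = rat_mat B"
    note [simp] = carrier_matD[OF X'(1)]
    have "N * (rat_mat A * X') = N * rat_mat A * X'" by (simp add: mat_mult_assoc)
    with N(2) X' show "X' = N * rat_mat B" by (simp add: mat_one_mult)
  qed (rule carrier_matI; simp)
qed

text \<open>A null vector of an evaluated block matrix is a defect at (z : 1), and one of the
  leading coefficients is a defect at (-1 : 0). Thus \<open>defect_free\<close> yields trivial
  kernels, hence full ranks, at all finite points and at infinity.\<close>

lemma strongly_minimal_linearizationI:
  assumes real: "realization p m M B C D H" and free: "defect_free p m M B C"
  obtains A' B' C' D' where "strongly_minimal_linearization A' B' C' D' H"
    "rat_mat (system_matrix A' B' C' D') = four_block_mat M B C D"
    "is_pencil (system_matrix A' B' C' D')" "square_mat (system_matrix A' B' C' D')"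
proof -
  from real have pencils: "M \<in> pencil_mats p p" "B \<in> pencil_mats p m" "C \<in> pencil_mats m p" "D \<in> pencil_mats m m"
    and det: "det M \<noteq> 0" by (auto simp: realization_def)
  note carrier = pencils[THEN pencil_mats_carrier]
  from real obtain X where X: "X \<in> carrier_mat p m" "M * X + B = 0\<^sub>m p m" "C * X + D = H"
    by (auto simp: realization_def)
  obtain M1 M0 where M: "M1 \<in> carrier_mat p p" "M0 \<in> carrier_mat p p" "M = Z \<cdot>\<^sub>m cmat M1 + cmat M0"
    using pencil_matsE[OF pencils(1)] .
  obtain B1 B0 where B: "B1 \<in> carrier_mat p m" "B0 \<in> carrier_mat p m" "B = Z \<cdot>\<^sub>m cmat B1 + cmat B0"
    using pencil_matsE[OF pencils(2)] .
  obtain C1 C0 where C: "C1 \<in> carrier_mat m p" "C0 \<in> carrier_mat m p" "C = Z \<cdot>\<^sub>m cmat C1 + cmat C0"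
    using pencil_matsE[OF pencils(3)] .
  obtain D1 D0 where D: "D1 \<in> carrier_mat m m" "D0 \<in> carrier_mat m m" "D = Z \<cdot>\<^sub>m cmat D1 + cmat D0"
    using pencil_matsE[OF pencils(4)] .
  \<comment> \<open>The sign is reversed because the upper left block of
    \<open>system_matrix\<close> is - A, whereas M already is that block.\<close>
  define A' where "A' = poly_pencil (- M1) (- M0)"
  define B' where "B' = poly_pencil B1 B0"
  define C' where "C' = poly_pencil C1 C0"
  define D' where "D' = poly_pencil D1 D0"
  have mM: "- M1 \<in> carrier_mat p p" "- M0 \<in> carrier_mat p p" using M by auto
  note A' = poly_pencil[OF mM, folded A'_def]
  note B' = poly_pencil[OF B(1,2), folded B'_def B(3)]
  note C' = poly_pencil[OF C(1,2), folded C'_def C(3)]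
  note D' = poly_pencil[OF D(1,2), folded D'_def D(3)]
  have uA': "- A' = poly_pencil M1 M0"
    using M by (intro eq_matI) (auto simp: A'_def poly_pencil_def)
  have ruA: "rat_mat (- A') = M" unfolding uA' M(3) by (rule poly_pencil(3)[OF M(1,2)])
  hence rA: "rat_mat A' = - M" by (metis rat_mat_uminus uminus_uminus_mat)
  have detA: "det A' \<noteq> 0"
  proof
    assume "det A' = 0"
    hence "det (rat_mat A') = 0" by (simp add: rat_mat_def)
    moreover have "rat_mat A' = cst (-1) \<cdot>\<^sub>m M"
      unfolding rA by (intro eq_matI) (auto simp: cst.hom_uminus)
    ultimately show False using det by (simp add: det_smult cst.hom_uminus)
  qed
  note [simp] = carrier[THEN carrier_matD(1)] carrier[THEN carrier_matD(2)] carrier_matD[OF X(1)]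
  have "rat_mat A' * X = B"
  proof -
    have "- M * X = cst (-1) \<cdot>\<^sub>m (M * X)" using X(1) carrier
      by (intro eq_matI) (auto simp: cst.hom_uminus)
    moreover have "(M * X) $$ (i, j) = - B $$ (i, j)" if "i < p" "j < m" for i j
      using that arg_cong[OF X(2), of "\<lambda>A. A $$ (i, j)"] by (simp add: add_eq_0_iff2)
    ultimately show ?thesis unfolding rA
      by (intro eq_matI) (auto simp del: index_mult_mat(1) simp: cst.hom_uminus)
  qed
  hence transfer: "transfer_function A' B' C' D' = H"
    using transfer_function_states[OF A'(1) B'(1) C'(1) D'(1) detA] X B'(3) C'(3) D'(3) by metis
  have evA: "- eval_mat A' z = z \<cdot>\<^sub>m M1 + M0" for z
    unfolding A'(4) using M by (intro eq_matI) auto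
  have leadA: "- lead_mat A' = M1" unfolding A'(5) by simp
  have [simp]: "(z, 1 :: complex) \<noteq> (0, 0)" "(-1 :: complex, 0) \<noteq> (0 :: complex, 0)" for z :: complex by auto
  have "minimal_system A' B' C'"
    unfolding minimal_system_def evA B'(4) C'(4)
  proof (intro allI conjI)
    fix z
    have c: "z \<cdot>\<^sub>m M1 + M0 \<in> carrier_mat p p" "z \<cdot>\<^sub>m B1 + B0 \<in> carrier_mat p m" "z \<cdot>\<^sub>m C1 + C0 \<in> carrier_mat m p"
      using M B C by auto
    show "full_row_rank (append_cols (z \<cdot>\<^sub>m M1 + M0) (z \<cdot>\<^sub>m B1 + B0))"
    proof (rule full_row_rankI)
      show "append_cols (z \<cdot>\<^sub>m M1 + M0) (z \<cdot>\<^sub>m B1 + B0) \<in> carrier_mat p (p + m)"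
        by (rule append_cols_carrier[OF c(1,2)])
      fix x assume x: "x \<in> carrier_mat 1 p" "x * append_cols (z \<cdot>\<^sub>m M1 + M0) (z \<cdot>\<^sub>m B1 + B0) = 0\<^sub>m 1 (p + m)"
      note 0 = mult_append_cols_eq_0[OF c(1,2) x]
      show "x = 0\<^sub>m 1 p"
        by (rule defect_freeD(2)[OF free, of z 1 x "x * M1" "x * B1"])
           (use M(3) B(3) mult_pencil_root(1)[OF M(1,2) x(1) 0(1)] mult_pencil_root(1)[OF B(1,2) x(1) 0(2)]
             mult_carrier_mat[OF x(1) M(1)] mult_carrier_mat[OF x(1) B(1)] x(1) in auto)
    qed
    show "full_col_rank ((z \<cdot>\<^sub>m M1 + M0) @\<^sub>r (z \<cdot>\<^sub>m C1 + C0))"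
    proof (rule full_col_rankI)
      show "(z \<cdot>\<^sub>m M1 + M0) @\<^sub>r (z \<cdot>\<^sub>m C1 + C0) \<in> carrier_mat (p + m) p"
        using c by (intro carrier_append_rows)
      fix x assume x: "x \<in> carrier_mat p 1" "((z \<cdot>\<^sub>m M1 + M0) @\<^sub>r (z \<cdot>\<^sub>m C1 + C0)) * x = 0\<^sub>m (p + m) 1"
      note 0 = append_rows_mult_eq_0[OF c(1,3) x]
      show "x = 0\<^sub>m p 1"
        by (rule defect_freeD(1)[OF free, of z 1 x "M1 * x" "C1 * x"])
           (use M(3) C(3) pencil_mult_root(1)[OF M(1,2) x(1) 0(1)] pencil_mult_root(1)[OF C(1,2) x(1) 0(2)]
             mult_carrier_mat[OF M(1) x(1)] mult_carrier_mat[OF C(1) x(1)] x(1) in auto)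
    qed
  qed
  moreover have "minimal_system_at_infinity A' B' C'"
    unfolding minimal_system_at_infinity_def leadA B'(5) C'(5)
  proof
    show "full_row_rank (append_cols M1 B1)"
    proof (rule full_row_rankI)
      show "append_cols M1 B1 \<in> carrier_mat p (p + m)"
        by (rule append_cols_carrier[OF M(1) B(1)])
      fix x assume x: "x \<in> carrier_mat 1 p" "x * append_cols M1 B1 = 0\<^sub>m 1 (p + m)"
      note 0 = mult_append_cols_eq_0[OF M(1) B(1) x]
      show "x = 0\<^sub>m 1 p"
        by (rule defect_freeD(2)[OF free, of "-1" 0 x "x * M0" "x * B0"])
           (use M(3) B(3) mult_pencil_root(2)[OF M(1,2) x(1) 0(1)] mult_pencil_root(2)[OF B(1,2) x(1) 0(2)]
             mult_carrier_mat[OF x(1) M(2)] mult_carrier_mat[OF x(1) B(2)] x(1) in auto)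
    qed
    show "full_col_rank (M1 @\<^sub>r C1)"
    proof (rule full_col_rankI)
      show "M1 @\<^sub>r C1 \<in> carrier_mat (p + m) p"
        using M(1) C(1) by (intro carrier_append_rows)
      fix x assume x: "x \<in> carrier_mat p 1" "(M1 @\<^sub>r C1) * x = 0\<^sub>m (p + m) 1"
      note 0 = append_rows_mult_eq_0[OF M(1) C(1) x]
      show "x = 0\<^sub>m p 1"
        by (rule defect_freeD(1)[OF free, of "-1" 0 x "M0 * x" "C0 * x"])
           (use M(3) C(3) pencil_mult_root(2)[OF M(1,2) x(1) 0(1)] pencil_mult_root(2)[OF C(1,2) x(1) 0(2)]
             mult_carrier_mat[OF M(2) x(1)] mult_carrier_mat[OF C(2) x(1)] x(1) in auto)
    qed
  qed
  moreover have "linear_system A' B' C' D'"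
    unfolding linear_system_def using A'(1,2) B'(1,2) C'(1,2) D'(1,2) detA by blast
  ultimately have lin: "strongly_minimal_linearization A' B' C' D' H"
    using transfer by (simp add: strongly_minimal_linearization_def strongly_minimal_def)
  have "system_matrix A' B' C' D' = poly_pencil (four_block_mat M1 B1 C1 D1) (four_block_mat M0 B0 C0 D0)"
    unfolding system_matrix_def uA' using M(1,2) B(1,2) C(1,2) D(1,2)
    by (intro eq_matI) (auto simp: poly_pencil_def B'_def C'_def D'_def)
  hence pencil: "is_pencil (system_matrix A' B' C' D')"
    using poly_pencil(2)[OF four_block_carrier_mat[OF M(1) D(1)] four_block_carrier_mat[OF M(2) D(2)]] by simp
  have uA: "- A' \<in> carrier_mat p p" using A'(1) by auto
  have "rat_mat (system_matrix A' B' C' D') = four_block_mat M B C D"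
    unfolding system_matrix_def rat_mat_four_block[OF uA B'(1) C'(1) D'(1)] ruA B'(3) C'(3) D'(3) ..
  moreover have "square_mat (system_matrix A' B' C' D')"
    using uA D'(1) by (auto simp: system_matrix_def)
  ultimately show ?thesis using that lin pencil by blast
qed

lemma four_block_eqD:
  assumes "four_block_mat A B C D = four_block_mat A' B' C' D'"
    "A \<in> carrier_mat p q" "B \<in> carrier_mat p n" "C \<in> carrier_mat m q" "D \<in> carrier_mat m n"
    "A' \<in> carrier_mat p q" "B' \<in> carrier_mat p n" "C' \<in> carrier_mat m q" "D' \<in> carrier_mat m n"
  shows "A = A'" "B = B'" "C = C'" "D = D'"
proof -
  have eq: "four_block_mat A B C D $$ (i, j) = four_block_mat A' B' C' D' $$ (i, j)" for i j
    by (simp only: assms(1))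
  show "A = A'"
  proof (rule eq_matI)
    fix i j assume "i < dim_row A'" "j < dim_col A'"
    thus "A $$ (i, j) = A' $$ (i, j)" using eq[of i j] assms(2-) by simp
  qed (use assms in auto)
  show "B = B'"
  proof (rule eq_matI)
    fix i j assume "i < dim_row B'" "j < dim_col B'"
    thus "B $$ (i, j) = B' $$ (i, j)" using eq[of i "q + j"] assms(2-) by simp
  qed (use assms in auto)
  show "C = C'"
  proof (rule eq_matI)
    fix i j assume "i < dim_row C'" "j < dim_col C'"
    thus "C $$ (i, j) = C' $$ (i, j)" using eq[of "p + i" j] assms(2-) by simp
  qed (use assms in auto)
  show "D = D'"
  proof (rule eq_matI)
    fix i j assume "i < dim_row D'" "j < dim_col D'"
    thus "D $$ (i, j) = D' $$ (i, j)" using eq[of "p + i" "q + j"] assms(2-) by simp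
  qed (use assms in auto)
qed

section \<open>Symmetry of the transfer function\<close>

text \<open>The sign \<epsilon> treats the palindromic and anti-palindromic cases together. With M
  the upper left block, B = - M X, and the symmetry turns this into C = - \<open>adj X\<close> M.
  Both \<open>adj X\<close> B and C X therefore equal - \<open>adj X\<close> M X, so
  \<open>dag\<close> multiplies C X + D by \<epsilon>.\<close>

lemma dag_transfer_function:
  assumes lin: "strongly_minimal_linearization A B C D H"
    and H: "H \<in> carrier_mat m m" and \<epsilon>: "\<epsilon> = cst 1 \<or> \<epsilon> = cst (-1)"
    and L: "dag (rat_mat (system_matrix A B C D)) = \<epsilon> \<cdot>\<^sub>m rat_mat (system_matrix A B C D)"
  shows "dag H = \<epsilon> \<cdot>\<^sub>m H"
proof -
  from lin have sys: "linear_system A B C D" and transfer: "transfer_function A B C D = H"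
    by (auto simp: strongly_minimal_linearization_def)
  from sys obtain p m' n where c: "A \<in> carrier_mat p p" "B \<in> carrier_mat p n" "C \<in> carrier_mat m' p"
    "D \<in> carrier_mat m' n" and det: "det A \<noteq> 0" by (auto simp: linear_system_def)
  obtain X where X: "X \<in> carrier_mat p n" "rat_mat A * X = rat_mat B" "rat_mat C * X + rat_mat D = H"
    using transfer_function_states[OF c det] transfer by metis
  have "m' = m" "n = m" using X(1,3) H c by auto
  note c = c[unfolded this] and X = X[unfolded this]
  define M where "M = rat_mat (- A)"
  have rA: "rat_mat A = cst (-1) \<cdot>\<^sub>m M"
    by (intro eq_matI) (auto simp: M_def rat_mat_def cst.hom_uminus)
  have M: "M \<in> carrier_mat p p" using c(1) by (auto simp: M_def)
  note r = M rat_mat_carrier[OF c(2)] rat_mat_carrier[OF c(3)] rat_mat_carrier[OF c(4)]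
  have uA: "- A \<in> carrier_mat p p" using c(1) by auto
  have rL: "rat_mat (system_matrix A B C D) = four_block_mat M (rat_mat B) (rat_mat C) (rat_mat D)"
    unfolding system_matrix_def rat_mat_four_block[OF uA c(2-4)] M_def ..
  have "four_block_mat (dag M) (dag (rat_mat C)) (dag (rat_mat B)) (dag (rat_mat D)) =
      four_block_mat (\<epsilon> \<cdot>\<^sub>m M) (\<epsilon> \<cdot>\<^sub>m rat_mat B) (\<epsilon> \<cdot>\<^sub>m rat_mat C) (\<epsilon> \<cdot>\<^sub>m rat_mat D)"
    using L unfolding rL dag_four_block[OF r] smult_four_block_mat[OF r] .
  note eqs = four_block_eqD[OF this dag_carrier[OF r(1)] dag_carrier[OF r(3)] dag_carrier[OF r(2)]
      dag_carrier[OF r(4)]]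
  have dag: "dag M = \<epsilon> \<cdot>\<^sub>m M" "dag (rat_mat C) = \<epsilon> \<cdot>\<^sub>m rat_mat B"
    "dag (rat_mat B) = \<epsilon> \<cdot>\<^sub>m rat_mat C" "dag (rat_mat D) = \<epsilon> \<cdot>\<^sub>m rat_mat D"
    using r by (intro eqs; simp)+
  note [simp] = c[THEN carrier_matD(1)] c[THEN carrier_matD(2)] carrier_matD[OF X(1)] carrier_matD[OF M]
  have BX: "rat_mat B = cst (-1) \<cdot>\<^sub>m (M * X)"
    unfolding X(2)[symmetric] rA by (simp add: mat_smult_mult)
  have \<epsilon>_nz: "\<epsilon> \<noteq> 0" using \<epsilon> by (auto simp: cst.hom_uminus)
  have real: "conj_recip (cst (-1)) = cst (-1)" by (simp only: conj_recip_cst complex_cnj_minus complex_cnj_one)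
  \<comment> \<open>The row counterpart of B = - M X is obtained by applying \<open>dag\<close>; the
    common sign \<epsilon> is then cancelled.\<close>
  have "\<epsilon> \<cdot>\<^sub>m rat_mat C = dag (cst (-1) \<cdot>\<^sub>m (M * X))"
    by (simp only: dag(3)[symmetric] BX)
  also have "\<dots> = cst (-1) \<cdot>\<^sub>m (adj X * dag M)"
    by (simp only: dag_smult real dag_mult(1)[OF M X(1)])
  also have "\<dots> = \<epsilon> \<cdot>\<^sub>m (cst (-1) \<cdot>\<^sub>m (adj X * M))"
    unfolding dag(1) by (simp only: mat_mult_smult dim_adj carrier_matD[OF X(1)] carrier_matD[OF M]
      mat_smult_smult mult.commute)
  finally have CX: "rat_mat C = cst (-1) \<cdot>\<^sub>m (adj X * M)"
    by (rule mat_smult_cancel[OF \<epsilon>_nz])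
  have "dag H = dag (rat_mat C * X) + dag (rat_mat D)"
    unfolding X(3)[symmetric] by (rule dag_add[OF _ r(4)]) (rule carrier_matI; simp)
  also have "\<dots> = \<epsilon> \<cdot>\<^sub>m (adj X * rat_mat B) + \<epsilon> \<cdot>\<^sub>m rat_mat D"
    unfolding dag_mult(1)[OF r(3) X(1)] dag by (simp add: mat_ring)
  also have "adj X * rat_mat B = rat_mat C * X"
    by (simp only: BX CX) (simp add: mat_ring)
  also have "\<epsilon> \<cdot>\<^sub>m (rat_mat C * X) + \<epsilon> \<cdot>\<^sub>m rat_mat D = \<epsilon> \<cdot>\<^sub>m H"
    unfolding X(3)[symmetric] by (simp add: mat_ring)
  finally show ?thesis .
qed

section \<open>Existence of symmetric strongly minimal linearizations\<close>

text \<open>Some palindromic realization exists, so there is one with the least number of states. A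
  column defect would let \<open>palindromic_realization_reduce\<close> lower that number, and
  \<open>dag\<close> turns row defects into column defects.\<close>

lemma defect_free_palindromic_realization:
  assumes "H \<in> carrier_mat m m" "dag H = H"
  obtains p M B C D where "palindromic_realization p m M B C D H" "defect_free p m M B C"
proof -
  define P where "P p \<longleftrightarrow> (\<exists>M B C D. palindromic_realization p m M B C D H)" for p
  have "\<exists>p. P p"
    using realization_exists[OF assms(1)] palindromic_realization_exists[OF _ assms] unfolding P_def by metis
  define p where "p = (LEAST p. P p)"
  have "P p" unfolding p_def by (rule LeastI_ex) fact
  then obtain M B C D where real: "palindromic_realization p m M B C D H" by (auto simp: P_def)
  from real have c: "M \<in> carrier_mat p p" "B \<in> carrier_mat p m" "C \<in> carrier_mat m p"
    and dag: "dag M = M" "dag C = B"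
    by (auto simp: palindromic_realization_def realization_def dest: pencil_mats_carrier)
  have dagB: "dag B = C" using dag(2) dag_dag[of C] by simp
  have col: "x = 0\<^sub>m p 1"
    if "(\<alpha>, \<beta>) \<noteq> (0, 0)" "x \<in> carrier_mat p 1" "a \<in> carrier_mat p 1" "c \<in> carrier_mat m 1"
      "M * cmat x = (Z * cst \<beta> - cst \<alpha>) \<cdot>\<^sub>m cmat a" "C * cmat x = (Z * cst \<beta> - cst \<alpha>) \<cdot>\<^sub>m cmat c"
    for \<alpha> \<beta> x a c
  proof (rule ccontr)
    assume "x \<noteq> 0\<^sub>m p 1"
    from palindromic_realization_reduce[OF real that(2) this that(3,4) pencil_root_nonzero[OF that(1)] that(5,6)]
    obtain q where "q < p" "P q" unfolding P_def by metis
    thus False using not_less_Least[of q P] by (simp add: p_def)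
  qed
  have row: "x = 0\<^sub>m 1 p"
    if "(\<alpha>, \<beta>) \<noteq> (0, 0)" "x \<in> carrier_mat 1 p" "a \<in> carrier_mat 1 p" "c \<in> carrier_mat 1 m"
      "cmat x * M = (Z * cst \<beta> - cst \<alpha>) \<cdot>\<^sub>m cmat a" "cmat x * B = (Z * cst \<beta> - cst \<alpha>) \<cdot>\<^sub>m cmat c"
    for \<alpha> \<beta> x a c
  proof -
    have cx: "cmat x \<in> carrier_mat 1 p" using that by simp
    \<comment> \<open>The scalar is rewritten as the linear form of the reflected point (-
      \<open>cnj\<close> \<beta> : - \<open>cnj\<close> \<alpha>), so that the column case applies
      literally.\<close>
    have root: "dag ((Z * cst \<beta> - cst \<alpha>) \<cdot>\<^sub>m cmat b) =
        (Z * cst (- cnj \<alpha>) - cst (- cnj \<beta>)) \<cdot>\<^sub>m cmat (ctranspose b)" for b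
      unfolding dag_smult
      by (simp add: dag_def mat_smult_smult dag_pencil_root cst.hom_uminus)
    have "ctranspose x = 0\<^sub>m p 1"
    proof (rule col)
      show "M * cmat (ctranspose x) = (Z * cst (- cnj \<alpha>) - cst (- cnj \<beta>)) \<cdot>\<^sub>m cmat (ctranspose a)"
        using arg_cong[OF that(5), of dag] unfolding root dag_mult(2)[OF cx c(1)] dag by simp
      show "C * cmat (ctranspose x) = (Z * cst (- cnj \<alpha>) - cst (- cnj \<beta>)) \<cdot>\<^sub>m cmat (ctranspose c)"
        using arg_cong[OF that(6), of dag] unfolding root dag_mult(2)[OF cx c(2)] dagB by simp
    qed (use that in auto)
    hence "ctranspose (ctranspose x) = ctranspose (0\<^sub>m p 1)" by simp
    also have "\<dots> = 0\<^sub>m 1 p" by (intro eq_matI) (auto simp: ctranspose_def)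
    finally show ?thesis by simp
  qed
  have "defect_free p m M B C"
    unfolding defect_free_def using col row by blast
  with real show ?thesis by (rule that)
qed

lemma realization_smult:
  assumes real: "realization p m M B C D H" and k: "k \<noteq> 0"
  shows "realization p m (cst k \<cdot>\<^sub>m M) (cst k \<cdot>\<^sub>m B) (cst k \<cdot>\<^sub>m C) (cst k \<cdot>\<^sub>m D) (cst k \<cdot>\<^sub>m H)"
proof -
  from real have pencils: "M \<in> pencil_mats p p" "B \<in> pencil_mats p m" "C \<in> pencil_mats m p" "D \<in> pencil_mats m m"
    and det: "det M \<noteq> 0" by (auto simp: realization_def)
  note carrier = pencils[THEN pencil_mats_carrier]
  from real obtain X where X: "X \<in> carrier_mat p m" "M * X + B = 0\<^sub>m p m" "C * X + D = H"
    by (auto simp: realization_def)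
  note [simp] = carrier[THEN carrier_matD(1)] carrier[THEN carrier_matD(2)] carrier_matD[OF X(1)]
  have "cst k \<cdot>\<^sub>m M * X + cst k \<cdot>\<^sub>m B = cst k \<cdot>\<^sub>m (M * X + B)" by (simp add: mat_ring)
  moreover have "cst k \<cdot>\<^sub>m C * X + cst k \<cdot>\<^sub>m D = cst k \<cdot>\<^sub>m (C * X + D)" by (simp add: mat_ring)
  moreover have "det (cst k \<cdot>\<^sub>m M) \<noteq> 0" using det k by (simp add: det_smult)
  ultimately show ?thesis using X pencils by (auto simp: realization_def smult_pencil_mats)
qed

text \<open>The factor 1/k is absorbed into the constant vectors a and c; the null vector x and the
  point stay the same.\<close>

lemma defect_free_smult:
  assumes free: "defect_free p m M B C" and k: "k \<noteq> 0"
    and c: "M \<in> carrier_mat p p" "B \<in> carrier_mat p m" "C \<in> carrier_mat m p"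
  shows "defect_free p m (cst k \<cdot>\<^sub>m M) (cst k \<cdot>\<^sub>m B) (cst k \<cdot>\<^sub>m C)"
proof -
  have scale: "F = \<mu> \<cdot>\<^sub>m cmat (inverse k \<cdot>\<^sub>m a)" if "cst k \<cdot>\<^sub>m F = \<mu> \<cdot>\<^sub>m cmat a" for F \<mu> a
  proof -
    have "F = cst (inverse k) \<cdot>\<^sub>m (cst k \<cdot>\<^sub>m F)"
      using k by (simp add: mat_smult_smult mat_one_smult flip: cst.hom_mult)
    also have "\<dots> = \<mu> \<cdot>\<^sub>m cmat (inverse k \<cdot>\<^sub>m a)"
      unfolding that cmat_smult by (simp add: mat_smult_smult mult.commute)
    finally show ?thesis .
  qed
  show ?thesis unfolding defect_free_def
  proof (intro conjI allI impI)
    fix \<alpha> \<beta> x a d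
    assume *: "(\<alpha>, \<beta>) \<noteq> (0, 0)" "x \<in> carrier_mat p 1" "a \<in> carrier_mat p 1" "d \<in> carrier_mat m 1"
      "cst k \<cdot>\<^sub>m M * cmat x = (Z * cst \<beta> - cst \<alpha>) \<cdot>\<^sub>m cmat a" "cst k \<cdot>\<^sub>m C * cmat x = (Z * cst \<beta> - cst \<alpha>) \<cdot>\<^sub>m cmat d"
    show "x = 0\<^sub>m p 1"
      by (rule defect_freeD(1)[OF free *(1,2), of "inverse k \<cdot>\<^sub>m a" "inverse k \<cdot>\<^sub>m d"])
         (use * c in \<open>auto intro!: scale simp: mat_smult_mult\<close>)
  next
    fix \<alpha> \<beta> x a d
    assume *: "(\<alpha>, \<beta>) \<noteq> (0, 0)" "x \<in> carrier_mat 1 p" "a \<in> carrier_mat 1 p" "d \<in> carrier_mat 1 m"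
      "cmat x * (cst k \<cdot>\<^sub>m M) = (Z * cst \<beta> - cst \<alpha>) \<cdot>\<^sub>m cmat a" "cmat x * (cst k \<cdot>\<^sub>m B) = (Z * cst \<beta> - cst \<alpha>) \<cdot>\<^sub>m cmat d"
    show "x = 0\<^sub>m 1 p"
      by (rule defect_freeD(2)[OF free *(1,2), of "inverse k \<cdot>\<^sub>m a" "inverse k \<cdot>\<^sub>m d"])
         (use * c in \<open>auto intro!: scale simp: mat_mult_smult\<close>)
  qed
qed

text \<open>Multiplication by \<open>k\<close> covers the anti-palindromic case with \<open>k = - \<i>\<close>.\<close>

lemma linearization_exists:
  assumes H: "H \<in> carrier_mat m m" "dag H = H" and k: "k \<noteq> 0"
  obtains A B C D where "strongly_minimal_linearization A B C D (cst k \<cdot>\<^sub>m H)"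
    "is_pencil (system_matrix A B C D)" "square_mat (system_matrix A B C D)"
    "dag (rat_mat (system_matrix A B C D)) = cst (cnj k / k) \<cdot>\<^sub>m rat_mat (system_matrix A B C D)"
proof -
  obtain p M B C D where real: "palindromic_realization p m M B C D H" and free: "defect_free p m M B C"
    using defect_free_palindromic_realization[OF H] .
  from real have real': "realization p m M B C D H" and dag: "dag M = M" "dag C = B" "dag D = D"
    by (auto simp: palindromic_realization_def)
  have c: "M \<in> carrier_mat p p" "B \<in> carrier_mat p m" "C \<in> carrier_mat m p" "D \<in> carrier_mat m m"
    using real' by (auto simp: realization_def dest: pencil_mats_carrier)
  have dagB: "dag B = C" using dag(2) dag_dag[of C] by simp
  obtain A' B' C' D' where sys: "strongly_minimal_linearization A' B' C' D' (cst k \<cdot>\<^sub>m H)"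
    "rat_mat (system_matrix A' B' C' D') =
      four_block_mat (cst k \<cdot>\<^sub>m M) (cst k \<cdot>\<^sub>m B) (cst k \<cdot>\<^sub>m C) (cst k \<cdot>\<^sub>m D)"
    "is_pencil (system_matrix A' B' C' D')" "square_mat (system_matrix A' B' C' D')"
    using strongly_minimal_linearizationI[OF realization_smult[OF real' k] defect_free_smult[OF free k c(1-3)]] .
  have L: "rat_mat (system_matrix A' B' C' D') = cst k \<cdot>\<^sub>m four_block_mat M B C D"
    unfolding sys(2) by (rule smult_four_block_mat[OF c, symmetric])
  have "dag (four_block_mat M B C D) = four_block_mat M B C D"
    unfolding dag_four_block[OF c] dag dagB ..
  \<comment> \<open>\<open>dag\<close> is conjugate-linear in constants, so the factor k becomes
    \<open>cnj k\<close>, that is, \<open>cnj k / k\<close> times k.\<close>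
  hence "dag (rat_mat (system_matrix A' B' C' D')) = cst (cnj k / k) \<cdot>\<^sub>m rat_mat (system_matrix A' B' C' D')"
    unfolding L dag_smult using k by (simp add: mat_smult_smult flip: cst.hom_mult)
  with sys(1,3,4) show ?thesis by (rule that)
qed

text \<open>The reason for the factor 1 + z: it satisfies z (1 + 1/z) = 1 + z and thus absorbs the
  extra z in \<open>dag\<close>. The symmetry of H under \<open>dag\<close> becomes the symmetry of
  R under \<open>adj\<close>.\<close>

lemma dag_one_plus_smult: "dag (to_fract [:1, 1:] \<cdot>\<^sub>m R) = to_fract [:1, 1:] \<cdot>\<^sub>m adj R"
proof -
  have eq: "to_fract [:1, 1:] = 1 + Z"
    by (simp flip: to_fract_1 to_fract_add add: one_pCons)
  have "conj_recip (to_fract [:1, 1:]) * Z = to_fract [:1, 1:]"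
    unfolding eq by (simp add: conj_recip.hom_add distrib_right del: to_fract_add)
  thus ?thesis unfolding dag_smult by (simp add: dag_def mat_smult_smult)
qed

text \<open>Inverting the variable on both sides passes from one equation to the other, because this
  inversion is an involution and fixes the constant \<epsilon>.\<close>

lemma adj_eq_iff_mat_star:
  assumes "\<epsilon> = cst 1 \<or> \<epsilon> = cst (-1)"
  shows "adj R = \<epsilon> \<cdot>\<^sub>m R \<longleftrightarrow> mat_star R = \<epsilon> \<cdot>\<^sub>m mat_recip R"
proof -
  have adj: "adj R = mat_recip (mat_star R)"
    by (intro eq_matI) (auto simp: adj_def mat_recip_def mat_star_def conj_recip_def)
  have recip: "mat_recip (mat_recip F) = F" for F
    by (intro eq_matI) (auto simp: mat_recip_def)
  have smult: "mat_recip (\<epsilon> \<cdot>\<^sub>m F) = \<epsilon> \<cdot>\<^sub>m mat_recip F" for F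
    using assms
    by (intro eq_matI) (auto simp: mat_recip_def rat_recip.hom_mult rat_recip.hom_uminus cst.hom_uminus)
  show ?thesis unfolding adj by (metis recip smult)
qed

theorem theorem4p3:
  fixes R :: "complex poly fract mat" and m :: nat
  assumes "R \<in> carrier_mat m m"
  shows "(para_hermitian R \<longleftrightarrow>
            (\<exists>A B C D. strongly_minimal_linearization A B C D (to_fract [:1, 1:] \<cdot>\<^sub>m R) \<and>
                       star_palindromic (system_matrix A B C D)))
       \<and> (para_skew_hermitian R \<longleftrightarrow>
            (\<exists>A B C D. strongly_minimal_linearization A B C D (to_fract [:1, 1:] \<cdot>\<^sub>m R) \<and>
                       star_anti_palindromic (system_matrix A B C D)))"
proof -
  define H where "H = to_fract [:1, 1:] \<cdot>\<^sub>m R"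
  have H: "H \<in> carrier_mat m m" using assms by (simp add: H_def)
  have uminus: "- F = cst (-1) \<cdot>\<^sub>m F" and one: "F = cst 1 \<cdot>\<^sub>m F" for F
    by (intro eq_matI; simp add: cst.hom_uminus)+
  \<comment> \<open>The nonzero scalar 1 + z is cancelled.\<close>
  have adjH: "adj R = \<epsilon> \<cdot>\<^sub>m R \<longleftrightarrow> dag H = \<epsilon> \<cdot>\<^sub>m H" for \<epsilon>
  proof -
    have "\<epsilon> \<cdot>\<^sub>m H = to_fract [:1, 1:] \<cdot>\<^sub>m (\<epsilon> \<cdot>\<^sub>m R)" by (simp add: H_def mat_smult_smult mult.commute)
    moreover have "to_fract [:1, 1:] \<noteq> 0" by simp
    ultimately show ?thesis
      unfolding H_def dag_one_plus_smult by (metis mat_smult_cancel)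
  qed
  have "square_mat R" using assms by auto
  hence herm: "para_hermitian R \<longleftrightarrow> dag H = cst 1 \<cdot>\<^sub>m H"
    and skew: "para_skew_hermitian R \<longleftrightarrow> dag H = cst (-1) \<cdot>\<^sub>m H"
    unfolding para_hermitian_def para_skew_hermitian_def adjH[symmetric]
    using adj_eq_iff_mat_star[of "cst 1" R] adj_eq_iff_mat_star[of "cst (-1)" R]
    by (simp_all add: uminus mat_one_smult)
  have pal: "star_palindromic L \<longleftrightarrow> is_pencil L \<and> square_mat L \<and> dag (rat_mat L) = cst 1 \<cdot>\<^sub>m rat_mat L"
    and anti: "star_anti_palindromic L \<longleftrightarrow> is_pencil L \<and> square_mat L \<and> dag (rat_mat L) = cst (-1) \<cdot>\<^sub>m rat_mat L" for L
    unfolding star_palindromic_def star_anti_palindromic_def rev1_mat_star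
    by (simp_all only: uminus flip: one)
  have "dag H = cst 1 \<cdot>\<^sub>m H \<longleftrightarrow> (\<exists>A B C D. strongly_minimal_linearization A B C D H \<and>
      star_palindromic (system_matrix A B C D))"
  proof
    assume "dag H = cst 1 \<cdot>\<^sub>m H"
    hence "dag H = H" by (simp add: mat_one_smult)
    from linearization_exists[OF H this one_neq_zero]
    obtain A B C D where "strongly_minimal_linearization A B C D (cst 1 \<cdot>\<^sub>m H)"
      "is_pencil (system_matrix A B C D)" "square_mat (system_matrix A B C D)"
      "dag (rat_mat (system_matrix A B C D)) = cst (cnj 1 / 1) \<cdot>\<^sub>m rat_mat (system_matrix A B C D)"
      by metis
    hence "strongly_minimal_linearization A B C D H \<and> star_palindromic (system_matrix A B C D)"
      unfolding pal by (simp add: mat_one_smult)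
    thus "\<exists>A B C D. strongly_minimal_linearization A B C D H \<and> star_palindromic (system_matrix A B C D)"
      by blast
  qed (use dag_transfer_function[OF _ H] pal in blast)
  moreover have "dag H = cst (-1) \<cdot>\<^sub>m H \<longleftrightarrow> (\<exists>A B C D. strongly_minimal_linearization A B C D H \<and>
      star_anti_palindromic (system_matrix A B C D))"
  proof
    assume *: "dag H = cst (-1) \<cdot>\<^sub>m H"
    \<comment> \<open>Conjugating the imaginary unit supplies a second sign, so i H is fixed by
      \<open>dag\<close>. Scaling its linearization by - i recovers H, and the quotient of
      \<open>cnj (- i)\<close> by - i is the required sign -1.\<close>
    have k: "conj_recip (cst \<i>) * cst (-1) = cst \<i>" "cst (- \<i>) * cst \<i> = 1" "cnj (- \<i>) / - \<i> = -1"
      by (simp_all add: cst.hom_uminus flip: cst.hom_mult)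
    have "dag (cst \<i> \<cdot>\<^sub>m H) = cst \<i> \<cdot>\<^sub>m H"
      unfolding dag_smult * mat_smult_smult k ..
    moreover have "cst \<i> \<cdot>\<^sub>m H \<in> carrier_mat m m" using H by simp
    moreover have "- \<i> \<noteq> 0" by simp
    ultimately obtain A B C D where
      "strongly_minimal_linearization A B C D (cst (- \<i>) \<cdot>\<^sub>m (cst \<i> \<cdot>\<^sub>m H))"
      "is_pencil (system_matrix A B C D)" "square_mat (system_matrix A B C D)"
      "dag (rat_mat (system_matrix A B C D)) = cst (cnj (- \<i>) / - \<i>) \<cdot>\<^sub>m rat_mat (system_matrix A B C D)"
      using linearization_exists by metis
    hence "strongly_minimal_linearization A B C D H \<and> star_anti_palindromic (system_matrix A B C D)"
      unfolding anti mat_smult_smult k mat_one_smult by blast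
    thus "\<exists>A B C D. strongly_minimal_linearization A B C D H \<and> star_anti_palindromic (system_matrix A B C D)"
      by blast
  qed (use dag_transfer_function[OF _ H] anti in blast)
  ultimately show ?thesis unfolding herm skew H_def by blast
qed

end
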